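(* Let $G$ and $H$ be étale groupoids and $X$ a $G$-$H$-bispace. Assume that the right momentum map $s_X\colon X\to H^{(0)}$ is a local homeomorphism. Let $\lambda$ be a continuous family of measures with full support along $s_X$, and assume that $(X,\lambda)$ is a topological correspondence from $G$ to $H$. Let $\tau^{s_X}$ be the family of measures consisting of point masses along $s_X$. Then $(X,\tau^{s_X})$ is a topological correspondence from $G$ to $H$, and the identity map $\mathrm{Id}_X\colon X\to X$ induces an isomorphism of topological correspondences (between $(X,\lambda)$ and $(X,\tau^{s_X})$).
   Context: Étale groupoid: a topological groupoid $G$ whose range map $r_G$ is a local homeomorphism, whose unit space $G^{(0)}$ is a locally compact Hausdorff subspace, and which is covered by countably many compact (Hausdorff) sets whose interiors form a basis of the topology of $G$. It is equipped with its canonical Haar system of counting measures $\alpha^u$ on $r_G^{-1}(u)$. Local homeomorphisms are continuous and surjective. The family $\tau^{s_X}=\{\tau^{s_X}_u\}_{u\in H^{(0)}}$ is given by $\int_X g\,d\tau^{s_X}_u=\sum_{x\in s_X^{-1}(u)}g(x)$ for $g\in C_c(X)$. Conventions. Measures are positive, Radon and $\sigma$-finite. $G\times_{G^{(0)}}X=\{(\gamma,x):s_G(\gamma)=r_X(x)\}$ with $r_X\colon X\to G^{(0)}$ the left momentum map; it is the arrow space of $G\ltimes X$. A $G$-$H$-bispace carries commuting continuous left $G$- and right $H$-actions. The $H$-action is proper if $(x,\eta)\mapsto(x\eta,x)$ into $X\times X$ is a proper map (inverse images of quasi-compact sets are quasi-compact). For a locally compact space $Z$, $C_c(Z)$ is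 the linear span of extensions by zero of continuous compactly supported functions on open Hausdorff subsets. A continuous family of measures $\lambda=\{\lambda_u\}_{u\in H^{(0)}}$ along $s_X$ consists of measures $\lambda_u$ supported in $s_X^{-1}(u)$ with $u\mapsto\int f\,d\lambda_u$ continuous for $f\in C_c(X)$; it has full support if $\mathrm{supp}(\lambda_u)=s_X^{-1}(u)$ for all $u$, is proper if all $\lambda_u\ne0$, and is $H$-invariant if $\int f(x\eta)\,d\lambda_{r_H(\eta)}(x)=\int f\,d\lambda_{s_H(\eta)}$ for all $\eta\in H$. A topological correspondence from $(G,\alpha)$ to $(H,\beta)$ is a pair $(X,\lambda)$ where $X$ is a locally compact $G$-$H$-bispace with proper $H$-action, $\lambda$ is an $H$-invariant proper continuous family of measures along $s_X$, and there is a continuous function $\Delta\colon G\ltimes X\to(0,\infty)$ with $$\int\!\!\int F(\gamma^{-1},x)\,d\alpha^{r_X(x)}(\gamma)\,d\lambda_u(x)=\int\!\!\int F(\gamma,\gamma^{-1}x)\,\Delta(\gamma,\gamma^{-1}x)\,d\alpha^{r_X(x)}(\gamma)\,d\lambda_u(x)$$ for all $u\in H^{(0)}$ and $F\in C_c(G\times_{G^{(0)}}X)$. An isomorphism of topological correspondences $(X,\lambda)\to(Y,\mu)$ from $G$ to $H$ is a $G$-$H$-equivariant homeomorphism $\phi\colon X\to Y$ such that for every $u\in H^{(0)}$ the measures $\phi_*(\lambda_u)$ and $\mu_u$ are equivalent and the Radon–Nikodym derivative $y\mapsto\frac{d\phi_*(\lambda_{s_Y(y)})}{d\mu_{s_Y(y)}}(y)$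 is (represented by) a positive continuous function on $Y$. *)

theory Defs
  imports "HOL-Analysis.Analysis"
begin

section \<open>Topological preliminaries\<close>

text \<open>Spaces need not be Hausdorff: \<open>compactin\<close> is quasi-compactness, and
  locally compact spaces are locally Hausdorff.\<close>

definition loc_compact :: "'x topology \<Rightarrow> bool" where
  "loc_compact X \<longleftrightarrow> (\<forall>x \<in> topspace X. \<exists>U K. openin X U \<and> x \<in> U \<and> U \<subseteq> K \<and>
     compactin X K \<and> Hausdorff_space (subtopology X K))"

definition local_homeomorphism :: "'x topology \<Rightarrow> 'y topology \<Rightarrow> ('x \<Rightarrow> 'y) \<Rightarrow> bool" where
  "local_homeomorphism X Y f \<longleftrightarrow>
     continuous_map X Y f \<and> f ` topspace X = topspace Y \<and>
     (\<forall>x \<in> topspace X. \<exists>U. openin X U \<and> x \<in> U \<and> openin Y (f ` U) \<and>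
        homeomorphic_map (subtopology X U) (subtopology Y (f ` U)) f)"

definition fibre :: "'x topology \<Rightarrow> ('x \<Rightarrow> 'y) \<Rightarrow> 'y \<Rightarrow> 'x set" where
  "fibre X p u = {x \<in> topspace X. p x = u}"

text \<open>Functions on a space are total on the type; \<open>ext_Cc Z\<close> consists of extensions by
  zero to the whole type.\<close>

definition ext_Cc :: "'z topology \<Rightarrow> ('z \<Rightarrow> complex) set" where
  "ext_Cc Z = {f. \<exists>U. openin Z U \<and> Hausdorff_space (subtopology Z U) \<and>
     continuous_map (subtopology Z U) euclidean f \<and>
     compactin (subtopology Z U) (subtopology Z U closure_of {z \<in> U. f z \<noteq> 0}) \<and>
     (\<forall>z. z \<notin> U \<longrightarrow> f z = 0)}"

definition Cc :: "'z topology \<Rightarrow> ('z \<Rightarrow> complex) set" where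
  "Cc Z = {f. \<exists>(n::nat) c g. (\<forall>i<n. g i \<in> ext_Cc Z) \<and> f = (\<lambda>z. \<Sum>i<n. c i * g i z)}"

section \<open>Measures\<close>

definition borel_of :: "'x topology \<Rightarrow> 'x measure" where
  "borel_of X = sigma (topspace X) {U. openin X U}"

text \<open>On a space that is only locally Hausdorff, a Borel measure is Radon if its restriction to
  every open Hausdorff subset is Radon.  Compact subsets of an open Hausdorff set are relatively
  closed in it, hence Borel.\<close>

definition radon_measure :: "'x topology \<Rightarrow> 'x measure \<Rightarrow> bool" where
  "radon_measure X M \<longleftrightarrow> sets M = sets (borel_of X) \<and>
     (\<forall>U. openin X U \<and> Hausdorff_space (subtopology X U) \<longrightarrow>
        (\<forall>K. compactin X K \<and> K \<subseteq> U \<longrightarrow> emeasure M K < \<infinity>) \<and>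
        (\<forall>A \<in> sets M. A \<subseteq> U \<longrightarrow>
           emeasure M A = (INF V \<in> {V. openin X V \<and> A \<subseteq> V \<and> V \<subseteq> U}. emeasure M V)) \<and>
        (\<forall>V. openin X V \<and> V \<subseteq> U \<longrightarrow>
           emeasure M V = (SUP K \<in> {K. compactin X K \<and> K \<subseteq> V}. emeasure M K)))"

definition measure_supp :: "'x topology \<Rightarrow> 'x measure \<Rightarrow> 'x set" where
  "measure_supp X M = {x \<in> topspace X. \<forall>U. openin X U \<and> x \<in> U \<longrightarrow> emeasure M U \<noteq> 0}"

definition continuous_family ::
    "'x topology \<Rightarrow> 'u topology \<Rightarrow> ('x \<Rightarrow> 'u) \<Rightarrow> ('u \<Rightarrow> 'x measure) \<Rightarrow> bool" where
  "continuous_family X Y p lam \<longleftrightarrow>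
     (\<forall>u \<in> topspace Y. radon_measure X (lam u) \<and> sigma_finite_measure (lam u) \<and>
        (AE x in lam u. p x = u)) \<and>
     (\<forall>f \<in> Cc X. continuous_map Y euclidean (\<lambda>u. LINT x|lam u. f x))"

definition full_support ::
    "'x topology \<Rightarrow> 'u topology \<Rightarrow> ('x \<Rightarrow> 'u) \<Rightarrow> ('u \<Rightarrow> 'x measure) \<Rightarrow> bool" where
  "full_support X Y p lam \<longleftrightarrow> (\<forall>u \<in> topspace Y. measure_supp X (lam u) = fibre X p u)"

definition proper_family :: "'x topology \<Rightarrow> 'u topology \<Rightarrow> ('u \<Rightarrow> 'x measure) \<Rightarrow> bool" where
  "proper_family X Y lam \<longleftrightarrow> (\<forall>u \<in> topspace Y. emeasure (lam u) (topspace X) \<noteq> 0)"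

text \<open>The counting measure on the fibre of \<open>p\<close> over \<open>u\<close>, as a Borel measure on \<open>X\<close>.\<close>

definition fibre_counting :: "'x topology \<Rightarrow> ('x \<Rightarrow> 'u) \<Rightarrow> 'u \<Rightarrow> 'x measure" where
  "fibre_counting X p u = distr (count_space (fibre X p u)) (borel_of X) (\<lambda>x. x)"

lemma space_borel_of: "space (borel_of X) = topspace X"
  unfolding borel_of_def by (rule space_measure_of) (auto dest: openin_subset)

lemma integral_fibre_counting:
  fixes g :: "'x \<Rightarrow> complex"
  assumes "g \<in> borel_measurable (borel_of X)" and "finite {x \<in> fibre X p u. g x \<noteq> 0}"
  shows "(LINT x|fibre_counting X p u. g x) = (\<Sum>x | x \<in> fibre X p u \<and> g x \<noteq> 0. g x)"
proof -
  have "(\<lambda>x. x) \<in> measurable (count_space (fibre X p u)) (borel_of X)"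
    by (auto simp: fibre_def space_borel_of)
  then have "(LINT x|fibre_counting X p u. g x) = (LINT x|count_space (fibre X p u). g x)"
    unfolding fibre_counting_def using assms(1) by (rule integral_distr)
  also have "\<dots> = (\<Sum>x | x \<in> fibre X p u \<and> g x \<noteq> 0. g x)"
    using assms(2) by (rule lebesgue_integral_count_space_finite_support)
  finally show ?thesis .
qed

section \<open>Groupoids\<close>

text \<open>The arrow set is the underlying set of \<open>arr_top\<close>; units are identified with
  identity arrows.  The operations are only meaningful on (composable) arrows.\<close>

record 'g gpd =
  arr_top :: "'g topology"
  rng :: "'g \<Rightarrow> 'g"
  src :: "'g \<Rightarrow> 'g"
  gmul :: "'g \<Rightarrow> 'g \<Rightarrow> 'g"
  ginv :: "'g \<Rightarrow> 'g"

definition arrows :: "'g gpd \<Rightarrow> 'g set" where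
  "arrows G = topspace (arr_top G)"

definition units :: "'g gpd \<Rightarrow> 'g set" where
  "units G = rng G ` arrows G"

definition unit_top :: "'g gpd \<Rightarrow> 'g topology" where
  "unit_top G = subtopology (arr_top G) (units G)"

locale groupoid =
  fixes G :: "'g gpd"
  assumes rng_closed: "g \<in> arrows G \<Longrightarrow> rng G g \<in> arrows G"
    and src_closed: "g \<in> arrows G \<Longrightarrow> src G g \<in> arrows G"
    and rng_rng: "g \<in> arrows G \<Longrightarrow> rng G (rng G g) = rng G g"
    and src_rng: "g \<in> arrows G \<Longrightarrow> src G (rng G g) = rng G g"
    and rng_src: "g \<in> arrows G \<Longrightarrow> rng G (src G g) = src G g"
    and src_src: "g \<in> arrows G \<Longrightarrow> src G (src G g) = src G g"
    and mul_closed: "\<lbrakk>g \<in> arrows G; h \<in> arrows G; src G g = rng G h\<rbrakk> \<Longrightarrow> gmul G g h \<in> arrows G"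
    and rng_mul: "\<lbrakk>g \<in> arrows G; h \<in> arrows G; src G g = rng G h\<rbrakk> \<Longrightarrow> rng G (gmul G g h) = rng G g"
    and src_mul: "\<lbrakk>g \<in> arrows G; h \<in> arrows G; src G g = rng G h\<rbrakk> \<Longrightarrow> src G (gmul G g h) = src G h"
    and mul_assoc: "\<lbrakk>g \<in> arrows G; h \<in> arrows G; k \<in> arrows G; src G g = rng G h; src G h = rng G k\<rbrakk>
      \<Longrightarrow> gmul G (gmul G g h) k = gmul G g (gmul G h k)"
    and mul_unit_left: "g \<in> arrows G \<Longrightarrow> gmul G (rng G g) g = g"
    and mul_unit_right: "g \<in> arrows G \<Longrightarrow> gmul G g (src G g) = g"
    and inv_closed: "g \<in> arrows G \<Longrightarrow> ginv G g \<in> arrows G"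
    and rng_inv: "g \<in> arrows G \<Longrightarrow> rng G (ginv G g) = src G g"
    and src_inv: "g \<in> arrows G \<Longrightarrow> src G (ginv G g) = rng G g"
    and mul_inv_right: "g \<in> arrows G \<Longrightarrow> gmul G g (ginv G g) = rng G g"
    and mul_inv_left: "g \<in> arrows G \<Longrightarrow> gmul G (ginv G g) g = src G g"

locale topological_groupoid = groupoid +
  assumes continuous_rng: "continuous_map (arr_top G) (unit_top G) (rng G)"
    and continuous_src: "continuous_map (arr_top G) (unit_top G) (src G)"
    and continuous_inv: "continuous_map (arr_top G) (arr_top G) (ginv G)"
    and continuous_mul:
      "continuous_map
         (subtopology (prod_topology (arr_top G) (arr_top G)) {(g, h). src G g = rng G h})
         (arr_top G) (\<lambda>(g, h). gmul G g h)"

locale etale_groupoid = topological_groupoid +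
  assumes rng_local_homeomorphism: "local_homeomorphism (arr_top G) (unit_top G) (rng G)"
    and units_Hausdorff: "Hausdorff_space (unit_top G)"
    and units_locally_compact: "locally_compact_space (unit_top G)"
    and countable_compact_cover:
      "\<exists>\<K>. countable \<K> \<and>
         (\<forall>K \<in> \<K>. compactin (arr_top G) K \<and> Hausdorff_space (subtopology (arr_top G) K)) \<and>
         \<Union>\<K> = arrows G \<and>
         openin (arr_top G) = arbitrary union_of (\<lambda>W. W \<in> (\<lambda>K. arr_top G interior_of K) ` \<K>)"

text \<open>The canonical Haar system of an etale groupoid.\<close>

abbreviation haar_counting :: "'g gpd \<Rightarrow> 'g \<Rightarrow> 'g measure" where
  "haar_counting G \<equiv> fibre_counting (arr_top G) (rng G)"

section \<open>Bispaces\<close>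

text \<open>\<open>lmom\<close> and \<open>rmom\<close> are the momentum maps \<open>r\<^sub>X\<close> and \<open>s\<^sub>X\<close>.\<close>

record ('g, 'h, 'x) bisp =
  bs_top :: "'x topology"
  lmom :: "'x \<Rightarrow> 'g"
  rmom :: "'x \<Rightarrow> 'h"
  lact :: "'g \<Rightarrow> 'x \<Rightarrow> 'x"
  ract :: "'x \<Rightarrow> 'h \<Rightarrow> 'x"

definition bs_points :: "('g, 'h, 'x) bisp \<Rightarrow> 'x set" where
  "bs_points X = topspace (bs_top X)"

definition left_prod_top :: "'g gpd \<Rightarrow> ('g, 'h, 'x) bisp \<Rightarrow> ('g \<times> 'x) topology" where
  "left_prod_top G X =
     subtopology (prod_topology (arr_top G) (bs_top X)) {(g, x). src G g = lmom X x}"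

definition right_prod_top :: "'h gpd \<Rightarrow> ('g, 'h, 'x) bisp \<Rightarrow> ('x \<times> 'h) topology" where
  "right_prod_top H X =
     subtopology (prod_topology (bs_top X) (arr_top H)) {(x, h). rmom X x = rng H h}"

locale bispace = G: topological_groupoid G + H: topological_groupoid H
  for G :: "'g gpd" and H :: "'h gpd" +
  fixes X :: "('g, 'h, 'x) bisp"
  assumes continuous_lmom: "continuous_map (bs_top X) (unit_top G) (lmom X)"
    and continuous_rmom: "continuous_map (bs_top X) (unit_top H) (rmom X)"
    and continuous_lact:
      "continuous_map (left_prod_top G X) (bs_top X) (\<lambda>(g, x). lact X g x)"
    and continuous_ract:
      "continuous_map (right_prod_top H X) (bs_top X) (\<lambda>(x, h). ract X x h)"
    and lmom_lact: "\<lbrakk>g \<in> arrows G; x \<in> bs_points X; src G g = lmom X x\<rbrakk>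
      \<Longrightarrow> lmom X (lact X g x) = rng G g"
    and rmom_ract: "\<lbrakk>x \<in> bs_points X; h \<in> arrows H; rmom X x = rng H h\<rbrakk>
      \<Longrightarrow> rmom X (ract X x h) = src H h"
    and lact_unit: "x \<in> bs_points X \<Longrightarrow> lact X (lmom X x) x = x"
    and ract_unit: "x \<in> bs_points X \<Longrightarrow> ract X x (rmom X x) = x"
    and lact_mul: "\<lbrakk>g \<in> arrows G; g' \<in> arrows G; x \<in> bs_points X;
        src G g = rng G g'; src G g' = lmom X x\<rbrakk>
      \<Longrightarrow> lact X (gmul G g g') x = lact X g (lact X g' x)"
    and ract_mul: "\<lbrakk>x \<in> bs_points X; h \<in> arrows H; h' \<in> arrows H;
        rmom X x = rng H h; src H h = rng H h'\<rbrakk>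
      \<Longrightarrow> ract X x (gmul H h h') = ract X (ract X x h) h'"
    and rmom_lact: "\<lbrakk>g \<in> arrows G; x \<in> bs_points X; src G g = lmom X x\<rbrakk>
      \<Longrightarrow> rmom X (lact X g x) = rmom X x"
    and lmom_ract: "\<lbrakk>x \<in> bs_points X; h \<in> arrows H; rmom X x = rng H h\<rbrakk>
      \<Longrightarrow> lmom X (ract X x h) = lmom X x"
    and actions_commute: "\<lbrakk>g \<in> arrows G; x \<in> bs_points X; h \<in> arrows H;
        src G g = lmom X x; rmom X x = rng H h\<rbrakk>
      \<Longrightarrow> ract X (lact X g x) h = lact X g (ract X x h)"

definition proper_right_action :: "'h gpd \<Rightarrow> ('g, 'h, 'x) bisp \<Rightarrow> bool" where
  "proper_right_action H X \<longleftrightarrow>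
     (\<forall>C. compactin (prod_topology (bs_top X) (bs_top X)) C \<longrightarrow>
        compactin (right_prod_top H X)
          {(x, h). (x, h) \<in> topspace (right_prod_top H X) \<and> (ract X x h, x) \<in> C})"

text \<open>The integrand \<open>x \<mapsto> f (x \<eta>)\<close> is only defined on the fibre over \<open>r \<eta>\<close>,
  hence the set integral.\<close>

definition right_invariant :: "'h gpd \<Rightarrow> ('g, 'h, 'x) bisp \<Rightarrow> ('h \<Rightarrow> 'x measure) \<Rightarrow> bool" where
  "right_invariant H X lam \<longleftrightarrow>
     (\<forall>\<eta> \<in> arrows H. \<forall>f \<in> Cc (bs_top X).
        (LINT x:fibre (bs_top X) (rmom X) (rng H \<eta>)|lam (rng H \<eta>). f (ract X x \<eta>))
        = (LINT x|lam (src H \<eta>). f x))"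

section \<open>Topological correspondences\<close>

text \<open>As above, the inner integrands are only defined on the fibre of the range map.\<close>

definition adjoining_function ::
    "'g gpd \<Rightarrow> ('g \<Rightarrow> 'g measure) \<Rightarrow> 'h gpd \<Rightarrow> ('g, 'h, 'x) bisp \<Rightarrow> ('h \<Rightarrow> 'x measure)
      \<Rightarrow> ('g \<times> 'x \<Rightarrow> real) \<Rightarrow> bool" where
  "adjoining_function G \<alpha> H X lam \<Delta> \<longleftrightarrow>
     continuous_map (left_prod_top G X) euclidean \<Delta> \<and>
     (\<forall>p \<in> topspace (left_prod_top G X). 0 < \<Delta> p) \<and>
     (\<forall>u \<in> units H. \<forall>F \<in> Cc (left_prod_top G X).
        (LINT x|lam u. (LINT \<gamma>:fibre (arr_top G) (rng G) (lmom X x)|\<alpha> (lmom X x).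
           F (ginv G \<gamma>, x)))
        = (LINT x|lam u. (LINT \<gamma>:fibre (arr_top G) (rng G) (lmom X x)|\<alpha> (lmom X x).
           F (\<gamma>, lact X (ginv G \<gamma>) x) * complex_of_real (\<Delta> (\<gamma>, lact X (ginv G \<gamma>) x)))))"

text \<open>The Haar system \<open>\<beta>\<close> of \<open>H\<close> is part of the data but does not enter the conditions.\<close>

definition topological_correspondence ::
    "'g gpd \<Rightarrow> ('g \<Rightarrow> 'g measure) \<Rightarrow> 'h gpd \<Rightarrow> ('h \<Rightarrow> 'h measure)
      \<Rightarrow> ('g, 'h, 'x) bisp \<Rightarrow> ('h \<Rightarrow> 'x measure) \<Rightarrow> bool" where
  "topological_correspondence G \<alpha> H \<beta> X lam \<longleftrightarrow>
     bispace G H X \<and> loc_compact (bs_top X) \<and> proper_right_action H X \<and>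
     continuous_family (bs_top X) (unit_top H) (rmom X) lam \<and>
     proper_family (bs_top X) (unit_top H) lam \<and>
     right_invariant H X lam \<and>
     (\<exists>\<Delta>. adjoining_function G \<alpha> H X lam \<Delta>)"

definition equivariant_homeomorphism ::
    "'g gpd \<Rightarrow> 'h gpd \<Rightarrow> ('g, 'h, 'x) bisp \<Rightarrow> ('g, 'h, 'y) bisp \<Rightarrow> ('x \<Rightarrow> 'y) \<Rightarrow> bool" where
  "equivariant_homeomorphism G H X Y \<phi> \<longleftrightarrow>
     homeomorphic_map (bs_top X) (bs_top Y) \<phi> \<and>
     (\<forall>x \<in> bs_points X. lmom Y (\<phi> x) = lmom X x \<and> rmom Y (\<phi> x) = rmom X x) \<and>
     (\<forall>g \<in> arrows G. \<forall>x \<in> bs_points X. src G g = lmom X x \<longrightarrow>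
        \<phi> (lact X g x) = lact Y g (\<phi> x)) \<and>
     (\<forall>x \<in> bs_points X. \<forall>h \<in> arrows H. rmom X x = rng H h \<longrightarrow>
        \<phi> (ract X x h) = ract Y (\<phi> x) h)"

definition correspondence_isomorphism ::
    "'g gpd \<Rightarrow> 'h gpd \<Rightarrow> ('g, 'h, 'x) bisp \<Rightarrow> ('h \<Rightarrow> 'x measure)
      \<Rightarrow> ('g, 'h, 'y) bisp \<Rightarrow> ('h \<Rightarrow> 'y measure) \<Rightarrow> ('x \<Rightarrow> 'y) \<Rightarrow> bool" where
  "correspondence_isomorphism G H X lam Y \<mu> \<phi> \<longleftrightarrow>
     equivariant_homeomorphism G H X Y \<phi> \<and>
     (\<forall>u \<in> units H.
        absolutely_continuous (\<mu> u) (distr (lam u) (borel_of (bs_top Y)) \<phi>) \<and>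
        absolutely_continuous (distr (lam u) (borel_of (bs_top Y)) \<phi>) (\<mu> u)) \<and>
     (\<exists>\<rho>. continuous_map (bs_top Y) euclideanreal \<rho> \<and> (\<forall>y \<in> bs_points Y. 0 < \<rho> y) \<and>
        (\<forall>u \<in> units H. AE y in \<mu> u.
           RN_deriv (\<mu> u) (distr (lam u) (borel_of (bs_top Y)) \<phi>) y = ennreal (\<rho> y)))"

end

theory Submission
  imports Defs
begin

text \<open>Write \<open>p\<close> for the right momentum map.  Since \<open>p\<close> is a local homeomorphism, its fibres are closed
and discrete, so a fibre measure \<open>lam u\<close> sees only single points.  Full support makes every atom
positive, the Radon property makes it finite, and \<open>\<sigma>\<close>-finiteness then leaves room for only countably
many points in a fibre.  Hence \<open>lam u\<close> is the counting measure of the fibre weighted by the function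
\<open>point_mass x = lam (p x) {x}\<close>.  This weight is continuous: if \<open>g\<close> is a bump function living on an
open set that \<open>p\<close> embeds, then \<open>\<integral> g d(lam (p x)) = point_mass x * g x\<close>, and the left-hand side
depends continuously on \<open>x\<close> because \<open>lam\<close> is a continuous family
(\<open>continuous_point_mass\<close>, \<open>lam_eq_density\<close>).

Everything about the comparison of the two families follows from this.  The identity is an
isomorphism with Radon-Nikodym derivative \<open>point_mass\<close>; and as division by \<open>point_mass\<close> preserves
\<open>C\<^sub>c\<close>, the continuity of \<open>lam\<close> gives that of the counting measures
(\<open>continuous_family_fibre_counting\<close>).

The remaining conditions on a correspondence concern counting measures alone.  Right translation by
an arrow of \<open>H\<close> is a bijection between fibres, so the counting measures are \<open>H\<close>-invariant.  The
counting measures are also invariant under \<open>G\<close>, so the constant 1 is an adjoining function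
(\<open>adjoining_function_fibre_counting\<close>): both iterated integrals
in the defining identity are sums of \<open>F\<close> over the pairs \<open>(g, y)\<close> with \<open>p y = u\<close>, the first
parametrised by \<open>(\<gamma>\<inverse>, x)\<close> and the second by \<open>(\<gamma>, \<gamma>\<inverse>x)\<close>.  These sums are finite because a compact
set meets a fibre of a local homeomorphism in finitely many points.  What needs care is that the
inner integral is a Borel function of \<open>x\<close> on a space that may fail to be Hausdorff
(\<open>borel_measurable_fibre_sum\<close>).\<close>

section \<open>Borel functions on topological spaces\<close>

lemma sets_borel_of_openin: "openin Z U \<Longrightarrow> U \<in> sets (borel_of Z)"
  unfolding borel_of_def by (subst sets_measure_of) (auto dest: openin_subset)

lemma sets_borel_of_closedin:
  assumes "closedin Z C"
  shows "C \<in> sets (borel_of Z)"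
proof -
  have "space (borel_of Z) - (topspace Z - C) \<in> sets (borel_of Z)"
    using assms by (intro sets.compl_sets sets_borel_of_openin) (simp add: closedin_def)
  then show ?thesis
    using closedin_subset[OF assms] by (simp add: space_borel_of double_diff)
qed

lemma continuous_map_measurable_borel_of:
  assumes "continuous_map Z W f"
  shows "f \<in> measurable (borel_of Z) (borel_of W)"
  unfolding borel_of_def[of W]
proof (rule measurable_measure_of)
  show "{U. openin W U} \<subseteq> Pow (topspace W)"
    by (auto dest: openin_subset)
  show "f \<in> space (borel_of Z) \<rightarrow> topspace W"
    using assms by (auto simp: space_borel_of continuous_map_def)
  fix U assume "U \<in> {U. openin W U}"
  then have "openin Z {x \<in> topspace Z. f x \<in> U}"
    using assms by (auto simp: continuous_map_def)
  moreover have "f -` U \<inter> space (borel_of Z) = {x \<in> topspace Z. f x \<in> U}"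
    by (auto simp: space_borel_of)
  ultimately show "f -` U \<inter> space (borel_of Z) \<in> sets (borel_of Z)"
    by (simp add: sets_borel_of_openin)
qed

lemma borel_of_euclidean: "borel_of euclidean = borel"
  by (simp add: borel_of_def borel_def)

text \<open>This gives measurability of functions described by a continuous map only on an open set, such as
elements of \<open>ext_Cc\<close> or the values of \<open>h\<close> along a local section.\<close>

lemma borel_measurable_extend_by_zero:
  fixes h :: "'w \<Rightarrow> complex"
  assumes U: "openin Z U" and \<phi>: "continuous_map (subtopology Z U) W \<phi>"
    and h: "h \<in> borel_measurable (borel_of W)"
  shows "(\<lambda>x. if x \<in> U then h (\<phi> x) else 0) \<in> borel_measurable (borel_of Z)"
proof -
  have sub: "U \<subseteq> topspace Z" using U by (rule openin_subset)
  have "\<phi> \<in> measurable (restrict_space (borel_of Z) U) (borel_of W)"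
    unfolding borel_of_def[of W]
  proof (rule measurable_measure_of)
    show "{U. openin W U} \<subseteq> Pow (topspace W)"
      by (auto dest: openin_subset)
    show "\<phi> \<in> space (restrict_space (borel_of Z) U) \<rightarrow> topspace W"
      using \<phi> by (auto simp: space_borel_of space_restrict_space continuous_map_def)
    fix V assume "V \<in> {U. openin W U}"
    then have "openin (subtopology Z U) {x \<in> topspace (subtopology Z U). \<phi> x \<in> V}"
      using \<phi> by (auto simp: continuous_map_def)
    then have "openin Z {x \<in> topspace (subtopology Z U). \<phi> x \<in> V}"
      using U openin_trans_full by blast
    moreover have "\<phi> -` V \<inter> space (restrict_space (borel_of Z) U)
        = {x \<in> topspace (subtopology Z U). \<phi> x \<in> V}"
      by (auto simp: space_borel_of space_restrict_space)
    ultimately show "\<phi> -` V \<inter> space (restrict_space (borel_of Z) U)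
        \<in> sets (restrict_space (borel_of Z) U)"
      using U sub
      by (auto simp: sets_restrict_space_iff space_borel_of Int_absorb2 sets_borel_of_openin)
  qed
  then have "(\<lambda>x. h (\<phi> x)) \<in> borel_measurable (restrict_space (borel_of Z) U)"
    using h by (rule measurable_compose)
  moreover have "{x \<in> space (borel_of Z). x \<in> U} \<in> sets (borel_of Z)"
    using U sub by (simp add: space_borel_of Int_absorb1 Collect_conj_eq sets_borel_of_openin)
  ultimately show ?thesis
    by (subst measurable_If_restrict_space_iff) auto
qed

lemma ext_CcE:
  assumes "f \<in> ext_Cc Z"
  obtains U where "openin Z U" and "Hausdorff_space (subtopology Z U)"
    and "continuous_map (subtopology Z U) euclidean f"
    and "compactin (subtopology Z U) (subtopology Z U closure_of {z \<in> U. f z \<noteq> 0})"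
    and "\<And>z. z \<notin> U \<Longrightarrow> f z = 0"
proof -
  from assms[unfolded ext_Cc_def mem_Collect_eq]
  obtain U where "openin Z U \<and> Hausdorff_space (subtopology Z U) \<and>
     continuous_map (subtopology Z U) euclidean f \<and>
     compactin (subtopology Z U) (subtopology Z U closure_of {z \<in> U. f z \<noteq> 0}) \<and>
     (\<forall>z. z \<notin> U \<longrightarrow> f z = 0)" ..
  then show ?thesis by (intro that[of U]) simp_all
qed

lemma ext_Cc_borel_compact_support:
  assumes "f \<in> ext_Cc Z"
  shows "f \<in> borel_measurable (borel_of Z) \<and> (\<exists>K. compactin Z K \<and> (\<forall>z. z \<notin> K \<longrightarrow> f z = 0))"
proof -
  obtain U where U: "openin Z U" and cf: "continuous_map (subtopology Z U) euclidean f"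
    and c: "compactin (subtopology Z U) (subtopology Z U closure_of {z \<in> U. f z \<noteq> 0})"
    and z: "\<And>z. z \<notin> U \<Longrightarrow> f z = 0"
    using assms by (rule ext_CcE) (rule that)
  let ?K = "subtopology Z U closure_of {z \<in> U. f z \<noteq> 0}"
  have "(\<lambda>x. if x \<in> U then f x else 0) \<in> borel_measurable (borel_of Z)"
    by (rule borel_measurable_extend_by_zero[OF U cf, of "\<lambda>z. z"]) (simp add: borel_of_euclidean)
  moreover have "(\<lambda>x. if x \<in> U then f x else 0) = f"
    using z by auto
  moreover have "compactin Z ?K"
    using c by (simp add: compactin_subtopology)
  moreover have "{z \<in> U. f z \<noteq> 0} \<subseteq> ?K"
    using openin_subset[OF U] by (intro closure_of_subset) auto
  then have "f z = 0" if "z \<notin> ?K" for z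
    using that z by auto
  ultimately show ?thesis
    by auto
qed

text \<open>These two properties are all that integration against counting measures uses of a function in \<open>C\<^sub>c\<close>.
Unlike membership in \<open>ext_Cc\<close>, they survive linear combinations and do not mention the Hausdorff open sets
on which the summands live.\<close>

lemma Cc_borel_compact_support:
  assumes "f \<in> Cc Z"
  shows "f \<in> borel_measurable (borel_of Z)"
    and "\<exists>K. compactin Z K \<and> (\<forall>z. z \<notin> K \<longrightarrow> f z = 0)"
proof -
  obtain n :: nat and c g where g: "\<And>i. i < n \<Longrightarrow> g i \<in> ext_Cc Z"
    and f: "f = (\<lambda>z. \<Sum>i<n. c i * g i z)"
    using assms unfolding Cc_def by auto
  show "f \<in> borel_measurable (borel_of Z)"
    unfolding f using g ext_Cc_borel_compact_support
    by (intro borel_measurable_sum borel_measurable_times borel_measurable_const) auto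
  have "\<forall>i<n. \<exists>K. compactin Z K \<and> (\<forall>z. z \<notin> K \<longrightarrow> g i z = 0)"
    using g ext_Cc_borel_compact_support by blast
  then obtain K where K: "\<And>i. i < n \<Longrightarrow> compactin Z (K i)"
    and K0: "\<And>i z. i < n \<Longrightarrow> z \<notin> K i \<Longrightarrow> g i z = 0"
    by metis
  have "compactin Z (\<Union>i<n. K i)"
    using K by (intro compactin_Union) auto
  moreover have "f z = 0" if "z \<notin> (\<Union>i<n. K i)" for z
    unfolding f using that K0 by (intro sum.neutral) auto
  ultimately show "\<exists>K. compactin Z K \<and> (\<forall>z. z \<notin> K \<longrightarrow> f z = 0)"
    by blast
qed

lemma continuous_map_if_locally_continuous:
  assumes "\<And>x. x \<in> topspace Z \<Longrightarrow>
      \<exists>W. openin Z W \<and> x \<in> W \<and> continuous_map (subtopology Z W) Y f"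
  shows "continuous_map Z Y f"
proof -
  obtain W where "\<And>x. x \<in> topspace Z \<Longrightarrow>
      openin Z (W x) \<and> x \<in> W x \<and> continuous_map (subtopology Z (W x)) Y f"
    using assms by metis
  then show ?thesis
    using pasting_lemma[of "topspace Z" Z W Y "\<lambda>_. f" f] by blast
qed

lemma continuous_map_complex_divide:
  fixes f g :: "'z \<Rightarrow> complex"
  assumes "continuous_map Z euclidean f" and "continuous_map Z euclidean g"
    and "\<And>z. z \<in> topspace Z \<Longrightarrow> g z \<noteq> 0"
  shows "continuous_map Z euclidean (\<lambda>z. f z / g z)"
  using assms unfolding continuous_map_atin limitin_canonical_iff by (intro ballI tendsto_divide) auto

text \<open>Division by \<open>\<rho>\<close> changes neither the open Hausdorff set nor the support of a summand.\<close>

lemma Cc_divide_continuous: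
  assumes "f \<in> Cc Z" and \<rho>: "continuous_map Z euclideanreal \<rho>"
    and pos: "\<And>x. x \<in> topspace Z \<Longrightarrow> \<rho> x \<noteq> 0"
  shows "(\<lambda>x. f x / complex_of_real (\<rho> x)) \<in> Cc Z"
proof -
  have ext: "(\<lambda>x. g x / complex_of_real (\<rho> x)) \<in> ext_Cc Z" if g: "g \<in> ext_Cc Z" for g
  proof -
    obtain U where U: "openin Z U" and Ha: "Hausdorff_space (subtopology Z U)"
      and cg: "continuous_map (subtopology Z U) euclidean g"
      and c: "compactin (subtopology Z U) (subtopology Z U closure_of {z \<in> U. g z \<noteq> 0})"
      and z: "\<And>z. z \<notin> U \<Longrightarrow> g z = 0"
      using g by (rule ext_CcE) (rule that)
    have sub: "U \<subseteq> topspace Z" using U by (rule openin_subset)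
    have "continuous_map (subtopology Z U) euclideanreal \<rho>"
      using \<rho> by (rule continuous_map_from_subtopology)
    then have "continuous_map (subtopology Z U) euclidean (\<lambda>x. g x / complex_of_real (\<rho> x))"
      using cg pos sub unfolding continuous_map_atin limitin_canonical_iff
      by (intro ballI tendsto_divide tendsto_of_real) auto
    moreover have "{z \<in> U. g z / complex_of_real (\<rho> z) \<noteq> 0} = {z \<in> U. g z \<noteq> 0}"
      using pos sub by auto
    ultimately show ?thesis
      unfolding ext_Cc_def using U Ha c z by auto
  qed
  obtain n :: nat and c g where g: "\<And>i. i < n \<Longrightarrow> g i \<in> ext_Cc Z"
    and f: "f = (\<lambda>z. \<Sum>i<n. c i * g i z)"
    using assms(1) unfolding Cc_def by auto
  have "\<forall>i<n. (\<lambda>x. g i x / complex_of_real (\<rho> x)) \<in> ext_Cc Z"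
    using g ext by auto
  moreover have "(\<lambda>x. f x / complex_of_real (\<rho> x))
      = (\<lambda>z. \<Sum>i<n. c i * (g i z / complex_of_real (\<rho> z)))"
    unfolding f by (simp add: sum_divide_distrib)
  ultimately show ?thesis
    unfolding Cc_def by (intro CollectI exI[of _ n] exI[of _ c]
        exI[of _ "\<lambda>i z. g i z / complex_of_real (\<rho> z)"]) auto
qed

lemma ext_Cc_subset_Cc: "ext_Cc Z \<subseteq> Cc Z"
proof
  fix f assume "f \<in> ext_Cc Z"
  then show "f \<in> Cc Z"
    unfolding Cc_def
    by (intro CollectI exI[of _ "1::nat"] exI[of _ "\<lambda>_. 1"] exI[of _ "\<lambda>_. f"]) auto
qed

section \<open>Local homeomorphisms\<close>

text \<open>Such a set \<open>U\<close> is the image of a continuous section of \<open>p\<close> over the open set \<open>p ` U\<close>.\<close>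

definition section_image :: "'z topology \<Rightarrow> 'y topology \<Rightarrow> ('z \<Rightarrow> 'y) \<Rightarrow> 'z set \<Rightarrow> bool" where
  "section_image Z Y p U \<longleftrightarrow> openin Z U \<and> openin Y (p ` U) \<and>
     homeomorphic_map (subtopology Z U) (subtopology Y (p ` U)) p"

lemma local_homeomorphismD:
  assumes "local_homeomorphism Z Y p"
  shows "continuous_map Z Y p" and "p ` topspace Z = topspace Y"
    and "x \<in> topspace Z \<Longrightarrow> \<exists>U. section_image Z Y p U \<and> x \<in> U"
  using assms unfolding local_homeomorphism_def section_image_def by auto

lemma section_imageD:
  assumes "section_image Z Y p U"
  shows "openin Z U" and "openin Y (p ` U)" and "inj_on p U"
    and "\<exists>\<sigma>. continuous_map (subtopology Y (p ` U)) (subtopology Z U) \<sigma> \<and>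
           (\<forall>y \<in> p ` U. \<sigma> y \<in> U \<and> p (\<sigma> y) = y) \<and> (\<forall>x \<in> U. \<sigma> (p x) = x)"
proof -
  show U: "openin Z U" and pU: "openin Y (p ` U)"
    using assms by (auto simp: section_image_def)
  have h: "homeomorphic_map (subtopology Z U) (subtopology Y (p ` U)) p"
    using assms by (simp add: section_image_def)
  have sub: "U \<subseteq> topspace Z" "p ` U \<subseteq> topspace Y"
    using U pU by (auto dest: openin_subset)
  show "inj_on p U"
    using homeomorphic_imp_injective_map[OF h] sub by (simp add: Int_absorb1)
  obtain \<sigma> where "homeomorphic_maps (subtopology Z U) (subtopology Y (p ` U)) p \<sigma>"
    using h homeomorphic_map_maps by blast
  then show "\<exists>\<sigma>. continuous_map (subtopology Y (p ` U)) (subtopology Z U) \<sigma> \<and>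
           (\<forall>y \<in> p ` U. \<sigma> y \<in> U \<and> p (\<sigma> y) = y) \<and> (\<forall>x \<in> U. \<sigma> (p x) = x)"
    using sub by (intro exI[of _ \<sigma>]) (auto simp: homeomorphic_maps_def Int_absorb1 subset_iff)
qed

lemma compactin_finite_section_cover:
  assumes "local_homeomorphism Z Y p" and "compactin Z K"
  obtains \<V> where "finite \<V>" and "\<And>V. V \<in> \<V> \<Longrightarrow> section_image Z Y p V" and "K \<subseteq> \<Union>\<V>"
proof -
  have K: "K \<subseteq> topspace Z" using assms(2) by (rule compactin_subset_topspace)
  have "K \<subseteq> \<Union>{U. section_image Z Y p U}"
    using K local_homeomorphismD(3)[OF assms(1)] by blast
  moreover have "\<forall>U \<in> {U. section_image Z Y p U}. openin Z U"
    by (auto simp: section_image_def)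
  ultimately obtain \<F> where "finite \<F>" "\<F> \<subseteq> {U. section_image Z Y p U}" "K \<subseteq> \<Union>\<F>"
    using assms(2) unfolding compactin_def by meson
  then show ?thesis using that by blast
qed

text \<open>Each \<open>V\<close> meets a fibre at most once.\<close>

lemma finite_fibre_in_sections:
  assumes "finite \<V>" and "\<And>V. V \<in> \<V> \<Longrightarrow> section_image Z Y p V"
  shows "finite {e \<in> \<Union>\<V>. p e = y}"
proof -
  have "{e \<in> \<Union>\<V>. p e = y} = (\<Union>V\<in>\<V>. {e \<in> V. p e = y})" by auto
  moreover have "finite {e \<in> V. p e = y}" if "V \<in> \<V>" for V
  proof -
    have "inj_on p V" using that assms(2) section_imageD(3) by blast
    then have "{e \<in> V. p e = y} = {} \<or> (\<exists>e0. {e \<in> V. p e = y} = {e0})"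
      unfolding inj_on_def by blast
    then show ?thesis by (metis finite.emptyI finite.insertI)
  qed
  ultimately show ?thesis using assms(1) by simp
qed

lemma finite_fibre_in_compact:
  assumes "local_homeomorphism Z Y p" and "compactin Z K"
  shows "finite {e \<in> K. p e = y}"
proof -
  obtain \<V> where "finite \<V>" "\<And>V. V \<in> \<V> \<Longrightarrow> section_image Z Y p V" "K \<subseteq> \<Union>\<V>"
    using compactin_finite_section_cover[OF assms] by blast
  then show ?thesis
    using finite_subset[OF _ finite_fibre_in_sections[of \<V> Z Y p y], of "{e \<in> K. p e = y}"] by blast
qed

text \<open>On a single \<open>V\<close> the sum has at most one term, \<open>h\<close> at the value of the local section.  The induction
step sets \<open>h\<close> to zero on \<open>V\<close> before summing over the other sets, so that points lying in several of
the sets are counted once.  This keeps \<open>h\<close> Borel, though not continuous, and so avoids partitions of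
unity, which may fail to exist on spaces that are only locally Hausdorff.\<close>

lemma borel_measurable_sum_over_sections:
  fixes h :: "'z \<Rightarrow> complex"
  assumes "finite \<V>" and "\<And>V. V \<in> \<V> \<Longrightarrow> section_image Z Y p V"
    and "h \<in> borel_measurable (borel_of Z)"
  shows "(\<lambda>y. \<Sum>e | e \<in> \<Union>\<V> \<and> p e = y. h e) \<in> borel_measurable (borel_of Y)"
  using assms
proof (induction \<V> arbitrary: h rule: finite_induct)
  case empty
  then show ?case by simp
next
  case (insert V \<V>)
  have V: "section_image Z Y p V" using insert by auto
  have oV: "openin Z V" using section_imageD(1)[OF V] .
  obtain \<sigma> where c\<sigma>: "continuous_map (subtopology Y (p ` V)) (subtopology Z V) \<sigma>"
    and \<sigma>: "\<And>y. y \<in> p ` V \<Longrightarrow> \<sigma> y \<in> V \<and> p (\<sigma> y) = y" "\<And>x. x \<in> V \<Longrightarrow> \<sigma> (p x) = x"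
    using section_imageD(4)[OF V] by blast
  let ?h' = "\<lambda>e. if e \<in> V then 0 else h e"
  have "?h' \<in> borel_measurable (borel_of Z)"
    using insert.prems(2) sets_borel_of_openin[OF oV] by (intro measurable_If_set) auto
  then have IH: "(\<lambda>y. \<Sum>e | e \<in> \<Union>\<V> \<and> p e = y. ?h' e) \<in> borel_measurable (borel_of Y)"
    using insert.prems(1) by (intro insert.IH) auto
  have "continuous_map (subtopology Y (p ` V)) Z \<sigma>"
    using c\<sigma> continuous_map_into_fulltopology by blast
  then have m: "(\<lambda>y. if y \<in> p ` V then h (\<sigma> y) else 0) \<in> borel_measurable (borel_of Y)"
    using section_imageD(2)[OF V] insert.prems(2) by (intro borel_measurable_extend_by_zero)
  have "(\<Sum>e | e \<in> \<Union>(insert V \<V>) \<and> p e = y. h e)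
      = (if y \<in> p ` V then h (\<sigma> y) else 0) + (\<Sum>e | e \<in> \<Union>\<V> \<and> p e = y. ?h' e)" for y
  proof -
    have fin: "finite {e \<in> \<Union>\<V>. p e = y}"
      using insert by (intro finite_fibre_in_sections) auto
    have V1: "{e \<in> V. p e = y} = (if y \<in> p ` V then {\<sigma> y} else {})"
    proof (cases "y \<in> p ` V")
      case True
      then have "e = \<sigma> y" if "e \<in> V" "p e = y" for e
        using \<sigma>(2)[OF that(1)] that(2) by simp
      then show ?thesis using \<sigma>(1)[OF True] True by auto
    qed auto
    have split: "{e. e \<in> \<Union>(insert V \<V>) \<and> p e = y}
        = {e \<in> V. p e = y} \<union> ({e \<in> \<Union>\<V>. p e = y} - V)"
      by auto
    have "finite {e \<in> V. p e = y}"
      unfolding V1 by simp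
    then have "(\<Sum>e | e \<in> \<Union>(insert V \<V>) \<and> p e = y. h e)
        = (\<Sum>e | e \<in> V \<and> p e = y. h e) + (\<Sum>e \<in> {e \<in> \<Union>\<V>. p e = y} - V. h e)"
      unfolding split using fin by (intro sum.union_disjoint) auto
    also have "(\<Sum>e \<in> {e \<in> \<Union>\<V>. p e = y} - V. h e) = (\<Sum>e | e \<in> \<Union>\<V> \<and> p e = y. ?h' e)"
      using fin by (intro sum.mono_neutral_cong_left) auto
    also have "(\<Sum>e | e \<in> V \<and> p e = y. h e) = (if y \<in> p ` V then h (\<sigma> y) else 0)"
      unfolding V1 by simp
    finally show ?thesis .
  qed
  then show ?case
    using borel_measurable_add[OF m IH] by simp
qed

text \<open>Since \<open>h\<close> vanishes off \<open>K\<close>, the sum over \<open>K\<close> may be enlarged to one over a finite cover by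
images of local sections.\<close>

lemma borel_measurable_fibre_sum:
  fixes h :: "'z \<Rightarrow> complex"
  assumes "local_homeomorphism Z Y p" and "compactin Z K"
    and h: "h \<in> borel_measurable (borel_of Z)" and h0: "\<And>e. e \<in> topspace Z \<Longrightarrow> e \<notin> K \<Longrightarrow> h e = 0"
  shows "(\<lambda>y. \<Sum>e | e \<in> K \<and> p e = y. h e) \<in> borel_measurable (borel_of Y)"
proof -
  obtain \<V> where \<V>: "finite \<V>" "\<And>V. V \<in> \<V> \<Longrightarrow> section_image Z Y p V" "K \<subseteq> \<Union>\<V>"
    using compactin_finite_section_cover[OF assms(1,2)] by blast
  have "\<Union>\<V> \<subseteq> topspace Z"
    using \<V>(2) by (auto simp: section_image_def dest: openin_subset)
  then have "(\<Sum>e | e \<in> K \<and> p e = y. h e) = (\<Sum>e | e \<in> \<Union>\<V> \<and> p e = y. h e)" for y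
    using finite_fibre_in_sections[OF \<V>(1,2)] \<V>(3) h0 by (intro sum.mono_neutral_left) auto
  then show ?thesis
    using borel_measurable_sum_over_sections[OF \<V>(1,2) h] by simp
qed

text \<open>The spaces \<open>left_prod_top G X\<close> and its variant with \<open>rng\<close> in place of \<open>src\<close> are both of this form.\<close>

definition fibre_product ::
    "'z topology \<Rightarrow> 'x topology \<Rightarrow> ('z \<Rightarrow> 'y) \<Rightarrow> ('x \<Rightarrow> 'y) \<Rightarrow> ('z \<times> 'x) topology" where
  "fibre_product Z X p q = subtopology (prod_topology Z X) {(z, x). p z = q x}"

lemma topspace_fibre_product:
  "topspace (fibre_product Z X p q) = {(z, x). z \<in> topspace Z \<and> x \<in> topspace X \<and> p z = q x}"
  by (auto simp: fibre_product_def)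

lemma continuous_map_into_fibre_product:
  "continuous_map W (fibre_product Z X p q) f \<longleftrightarrow>
     continuous_map W Z (\<lambda>w. fst (f w)) \<and> continuous_map W X (\<lambda>w. snd (f w)) \<and>
     (\<forall>w \<in> topspace W. p (fst (f w)) = q (snd (f w)))"
  by (auto simp: fibre_product_def continuous_map_in_subtopology continuous_map_pairwise o_def
      Pi_iff split_beta)

lemma continuous_map_fibre_product_projections:
  "continuous_map (fibre_product Z X p q) Z fst" "continuous_map (fibre_product Z X p q) X snd"
  using continuous_map_into_fibre_product[of "fibre_product Z X p q" Z X p q "\<lambda>w. w"] by auto

text \<open>A local section \<open>\<sigma>\<close> of \<open>p\<close> induces the local section \<open>x \<mapsto> (\<sigma> (q x), x)\<close> of the projection.\<close>

lemma local_homeomorphism_pullback: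
  assumes p: "local_homeomorphism Z Y p" and q: "continuous_map X Y q"
  shows "local_homeomorphism (fibre_product Z X p q) X snd"
  unfolding local_homeomorphism_def
proof (intro conjI ballI)
  let ?E = "fibre_product Z X p q"
  show cont: "continuous_map ?E X snd"
    by (rule continuous_map_fibre_product_projections)
  show "snd ` topspace ?E = topspace X"
  proof
    show "topspace X \<subseteq> snd ` topspace ?E"
    proof
      fix x assume x: "x \<in> topspace X"
      then have "q x \<in> p ` topspace Z"
        using q local_homeomorphismD(2)[OF p] by (auto simp: continuous_map_def)
      then obtain z where "z \<in> topspace Z" "p z = q x" by force
      then have "(z, x) \<in> topspace ?E" using x by (auto simp: topspace_fibre_product)
      then show "x \<in> snd ` topspace ?E" by force
    qed
  qed (auto simp: topspace_fibre_product)
  fix e assume "e \<in> topspace ?E"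
  then obtain z x where e: "e = (z, x)" and z: "z \<in> topspace Z" and x: "x \<in> topspace X"
    and zx: "p z = q x" by (auto simp: topspace_fibre_product)
  obtain A where A: "section_image Z Y p A" and zA: "z \<in> A"
    using local_homeomorphismD(3)[OF p z] by blast
  obtain \<sigma> where c\<sigma>: "continuous_map (subtopology Y (p ` A)) (subtopology Z A) \<sigma>"
    and \<sigma>: "\<And>y. y \<in> p ` A \<Longrightarrow> \<sigma> y \<in> A \<and> p (\<sigma> y) = y" "\<And>z. z \<in> A \<Longrightarrow> \<sigma> (p z) = z"
    using section_imageD(4)[OF A] by blast
  have AZ: "A \<subseteq> topspace Z" using section_imageD(1)[OF A] by (rule openin_subset)
  let ?U = "{e \<in> topspace ?E. fst e \<in> A}"
  let ?O = "{x \<in> topspace X. q x \<in> p ` A}"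
  have oU: "openin ?E ?U"
    using continuous_map_fibre_product_projections(1) section_imageD(1)[OF A]
    by (rule openin_continuous_map_preimage)
  have oO: "openin X ?O"
    using q section_imageD(2)[OF A] by (rule openin_continuous_map_preimage)
  have img: "snd ` ?U = ?O"
  proof
    show "?O \<subseteq> snd ` ?U"
    proof
      fix x assume "x \<in> ?O"
      then have "(\<sigma> (q x), x) \<in> ?U" using \<sigma>(1) AZ by (auto simp: topspace_fibre_product)
      then show "x \<in> snd ` ?U" by force
    qed
  qed (auto simp: topspace_fibre_product intro: image_eqI[OF sym])
  have cq: "continuous_map (subtopology X ?O) (subtopology Y (p ` A)) q"
    using q by (auto simp: continuous_map_in_subtopology continuous_map_from_subtopology)
  have "continuous_map (subtopology X ?O) (subtopology Z A) (\<sigma> \<circ> q)"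
    using cq c\<sigma> by (rule continuous_map_compose)
  then have c1: "continuous_map (subtopology X ?O) Z (\<lambda>x. \<sigma> (q x))"
    by (auto simp: continuous_map_in_subtopology o_def)
  have backward: "continuous_map (subtopology X ?O) (subtopology ?E ?U) (\<lambda>x. (\<sigma> (q x), x))"
    using c1 \<sigma> AZ
    by (auto simp: continuous_map_in_subtopology continuous_map_into_fibre_product
        topspace_fibre_product continuous_map_from_subtopology)
  have forward: "continuous_map (subtopology ?E ?U) (subtopology X ?O) snd"
    using cont img by (auto simp: continuous_map_in_subtopology continuous_map_from_subtopology)
  have "homeomorphic_maps (subtopology ?E ?U) (subtopology X ?O) snd (\<lambda>x. (\<sigma> (q x), x))"
    unfolding homeomorphic_maps_def
  proof (intro conjI forward backward ballI)
    fix e assume "e \<in> topspace (subtopology ?E ?U)"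
    then have "fst e \<in> A" "q (snd e) = p (fst e)" by (auto simp: topspace_fibre_product)
    then show "(\<sigma> (q (snd e)), snd e) = e" using \<sigma>(2) by (simp add: prod_eq_iff)
  qed simp
  then have "homeomorphic_map (subtopology ?E ?U) (subtopology X (snd ` ?U)) snd"
    unfolding img homeomorphic_map_maps by blast
  moreover have "e \<in> ?U" using e z x zx zA by (auto simp: topspace_fibre_product)
  ultimately show "\<exists>U. openin ?E U \<and> e \<in> U \<and> openin X (snd ` U) \<and>
      homeomorphic_map (subtopology ?E U) (subtopology X (snd ` U)) snd"
    using oU oO img by (intro exI[of _ ?U]) simp
qed

section \<open>Counting measures on the fibres\<close>

text \<open>The total space may fail to be Hausdorff, but it is covered by open Hausdorff sets, the images of
local sections.  Range maps of etale groupoids and the right momentum map are instances.\<close>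

locale etale_map =
  fixes Z :: "'z topology" and Y :: "'y topology" and p :: "'z \<Rightarrow> 'y"
  assumes local_homeo: "local_homeomorphism Z Y p" and base_Hausdorff: "Hausdorff_space Y"
begin

lemma continuous_p: "continuous_map Z Y p"
  using local_homeomorphismD(1)[OF local_homeo] .

lemma fibre_isolated:
  assumes "x \<in> topspace Z"
  obtains U where "section_image Z Y p U" and "x \<in> U" and "U \<inter> fibre Z p (p x) = {x}"
proof -
  obtain U where U: "section_image Z Y p U" "x \<in> U"
    using local_homeomorphismD(3)[OF local_homeo assms] by blast
  moreover have "U \<inter> fibre Z p (p x) = {x}"
    using section_imageD(3)[OF U(1)] U(2) assms by (auto simp: fibre_def inj_on_def)
  ultimately show ?thesis using that by blast
qed

lemma Hausdorff_section_image:
  assumes "section_image Z Y p U"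
  shows "Hausdorff_space (subtopology Z U)"
proof -
  have "subtopology Z U homeomorphic_space subtopology Y (p ` U)"
    using assms by (auto simp: section_image_def intro: homeomorphic_map_imp_homeomorphic_space)
  then show ?thesis
    using base_Hausdorff by (simp add: homeomorphic_Hausdorff_space Hausdorff_space_subtopology)
qed

lemma closedin_fibre: "closedin Z (fibre Z p u)"
proof (cases "u \<in> topspace Y")
  case True
  then have "closedin Y {u}"
    using base_Hausdorff by (simp add: closedin_Hausdorff_singleton)
  then have "closedin Z {x \<in> topspace Z. p x \<in> {u}}"
    using continuous_p by (rule closedin_continuous_map_preimage[rotated])
  then show ?thesis by (simp add: fibre_def)
next
  case False
  then have "fibre Z p u = {}"
    using continuous_p by (auto simp: fibre_def continuous_map_def)
  then show ?thesis by simp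
qed

text \<open>Fibres are closed and discrete, hence so are all their subsets; in particular each of them is Borel,
whatever its cardinality.\<close>

lemma closedin_subset_fibre:
  assumes S: "S \<subseteq> fibre Z p u"
  shows "closedin Z S"
proof -
  have "openin Z (topspace Z - S)"
  proof (subst openin_subopen, intro ballI)
    fix x assume x: "x \<in> topspace Z - S"
    show "\<exists>T. openin Z T \<and> x \<in> T \<and> T \<subseteq> topspace Z - S"
    proof (cases "p x = u")
      case True
      obtain U where U: "section_image Z Y p U" "x \<in> U" "U \<inter> fibre Z p (p x) = {x}"
        using fibre_isolated x by blast
      have "U \<inter> S \<subseteq> {x}"
        using U(3) S True by auto
      then have "U \<subseteq> topspace Z - S"
        using x openin_subset[OF section_imageD(1)[OF U(1)]] by auto
      then show ?thesis using U section_imageD(1)[OF U(1)] by blast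
    next
      case False
      have "openin Z (topspace Z - fibre Z p u)"
        using closedin_fibre by (simp add: openin_diff)
      moreover have "x \<in> topspace Z - fibre Z p u" "topspace Z - fibre Z p u \<subseteq> topspace Z - S"
        using x False S by (auto simp: fibre_def)
      ultimately show ?thesis by blast
    qed
  qed
  then show ?thesis using S by (auto simp: closedin_def fibre_def)
qed

lemma fibre_subset_borel: "S \<subseteq> fibre Z p u \<Longrightarrow> S \<in> sets (borel_of Z)"
  by (rule sets_borel_of_closedin[OF closedin_subset_fibre])

lemma singleton_borel: "x \<in> topspace Z \<Longrightarrow> {x} \<in> sets (borel_of Z)"
  by (rule fibre_subset_borel[of _ "p x"]) (auto simp: fibre_def)

lemma inclusion_measurable: "(\<lambda>x. x) \<in> measurable (count_space (fibre Z p u)) (borel_of Z)"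
  by (auto simp: fibre_def space_borel_of)

lemma sets_fibre_counting: "sets (fibre_counting Z p u) = sets (borel_of Z)"
  by (simp add: fibre_counting_def)

lemma space_fibre_counting: "space (fibre_counting Z p u) = topspace Z"
  by (simp add: fibre_counting_def space_borel_of)

lemma emeasure_fibre_counting:
  assumes "A \<in> sets (borel_of Z)"
  shows "emeasure (fibre_counting Z p u) A = emeasure (count_space (fibre Z p u)) (A \<inter> fibre Z p u)"
  unfolding fibre_counting_def using assms
  by (subst emeasure_distr[OF inclusion_measurable]) auto

lemma integral_fibre_counting_finite_support:
  fixes f :: "'z \<Rightarrow> complex"
  assumes "f \<in> borel_measurable (borel_of Z)" and "finite S" and "S \<subseteq> fibre Z p u"
    and "\<And>x. x \<in> fibre Z p u \<Longrightarrow> x \<notin> S \<Longrightarrow> f x = 0"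
  shows "(LINT x|fibre_counting Z p u. f x) = (\<Sum>x\<in>S. f x)"
proof -
  have sub: "{x \<in> fibre Z p u. f x \<noteq> 0} \<subseteq> S" using assms(4) by auto
  then have "finite {x \<in> fibre Z p u. f x \<noteq> 0}" using assms(2) finite_subset by blast
  then have "(LINT x|fibre_counting Z p u. f x) = (\<Sum>x | x \<in> fibre Z p u \<and> f x \<noteq> 0. f x)"
    using assms(1) by (intro integral_fibre_counting)
  also have "\<dots> = (\<Sum>x\<in>S. f x)"
    using assms sub by (intro sum.mono_neutral_left) auto
  finally show ?thesis .
qed

text \<open>Cut off to the fibre, \<open>f\<close> is a finite combination of indicators of Borel points, hence measurable
whatever its values elsewhere.  This covers integrands such as \<open>f (ract X x \<eta>)\<close>, which are meaningful
only on one fibre.\<close>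

lemma set_integral_fibre_counting_finite_support:
  fixes f :: "'z \<Rightarrow> complex"
  assumes "finite S" and "S \<subseteq> fibre Z p u"
    and "\<And>x. x \<in> fibre Z p u \<Longrightarrow> x \<notin> S \<Longrightarrow> f x = 0"
  shows "(LINT x:fibre Z p u|fibre_counting Z p u. f x) = (\<Sum>x\<in>S. f x)"
proof -
  have eq: "indicator (fibre Z p u) x *\<^sub>R f x = (\<Sum>s\<in>S. indicator {s} x *\<^sub>R f s)" for x
  proof -
    have "(\<Sum>s\<in>S. indicator {s} x *\<^sub>R f s) = (\<Sum>s\<in>S \<inter> {x}. indicator {s} x *\<^sub>R f s)"
      using assms(1) by (intro sum.mono_neutral_right) (auto simp: indicator_def)
    also have "\<dots> = (if x \<in> S then f x else 0)"
      by simp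
    finally show ?thesis using assms(2,3) by (auto simp: indicator_def)
  qed
  have "(\<lambda>x. \<Sum>s\<in>S. indicator {s} x *\<^sub>R f s) \<in> borel_measurable (borel_of Z)"
    using assms(2) singleton_borel
    by (intro borel_measurable_sum borel_measurable_scaleR borel_measurable_indicator) (auto simp: fibre_def)
  then have "(LINT x|fibre_counting Z p u. indicator (fibre Z p u) x *\<^sub>R f x)
      = (\<Sum>x\<in>S. indicator (fibre Z p u) x *\<^sub>R f x)"
    using assms eq by (intro integral_fibre_counting_finite_support) auto
  also have "\<dots> = (\<Sum>x\<in>S. f x)"
    using assms(2) by (intro sum.cong) auto
  finally show ?thesis by (simp add: set_lebesgue_integral_def)
qed

lemma AE_fibre_counting: "AE x in fibre_counting Z p u. p x = u"
proof (rule AE_I')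
  have "topspace Z - fibre Z p u \<in> sets (borel_of Z)"
    using closedin_fibre by (intro sets_borel_of_openin) (simp add: openin_diff)
  then show "topspace Z - fibre Z p u \<in> null_sets (fibre_counting Z p u)"
    by (simp add: null_sets_def sets_fibre_counting emeasure_fibre_counting Int_commute)
  show "{x \<in> space (fibre_counting Z p u). p x \<noteq> u} \<subseteq> topspace Z - fibre Z p u"
    by (auto simp: space_fibre_counting fibre_def)
qed

lemma sigma_finite_fibre_counting:
  assumes "countable (fibre Z p u)"
  shows "sigma_finite_measure (fibre_counting Z p u)"
proof
  let ?\<A> = "insert (topspace Z - fibre Z p u) ((\<lambda>x. {x}) ` fibre Z p u)"
  have comp: "topspace Z - fibre Z p u \<in> sets (borel_of Z)"
    using closedin_fibre by (intro sets_borel_of_openin) (simp add: openin_diff)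
  have "countable ?\<A>" using assms by simp
  moreover have "?\<A> \<subseteq> sets (fibre_counting Z p u)"
    using comp singleton_borel by (auto simp: sets_fibre_counting fibre_def)
  moreover have "\<Union>?\<A> = space (fibre_counting Z p u)"
    by (auto simp: space_fibre_counting fibre_def)
  moreover have "\<forall>a\<in>?\<A>. emeasure (fibre_counting Z p u) a \<noteq> \<infinity>"
    using comp singleton_borel
    by (auto simp: emeasure_fibre_counting fibre_def Int_commute[of _ "{x \<in> topspace Z. p x = u}"])
  ultimately show "\<exists>A. countable A \<and> A \<subseteq> sets (fibre_counting Z p u) \<and>
      \<Union>A = space (fibre_counting Z p u) \<and> (\<forall>a\<in>A. emeasure (fibre_counting Z p u) a \<noteq> \<infinity>)"
    by blast
qed

text \<open>Outer regularity is attained, by removing from \<open>U\<close> the closed set of fibre points outside \<open>A\<close>.  Inner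
regularity uses the finite subsets of the fibre as compact sets.\<close>

lemma radon_fibre_counting: "radon_measure Z (fibre_counting Z p u)"
  unfolding radon_measure_def
proof (intro conjI allI impI ballI)
  let ?\<tau> = "fibre_counting Z p u" and ?F = "fibre Z p u"
  show "sets ?\<tau> = sets (borel_of Z)" by (rule sets_fibre_counting)
  fix U assume U: "openin Z U \<and> Hausdorff_space (subtopology Z U)"
  show "emeasure ?\<tau> K < \<infinity>" if K: "compactin Z K \<and> K \<subseteq> U" for K
  proof (cases "K \<in> sets (borel_of Z)")
    case True
    have "finite {e \<in> K. p e = u}"
      using local_homeo K by (intro finite_fibre_in_compact) auto
    then have "finite (K \<inter> ?F)" by (rule finite_subset[rotated]) (auto simp: fibre_def)
    then show ?thesis using True by (simp add: emeasure_fibre_counting of_nat_less_top)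
  next
    case False
    then show ?thesis by (simp add: emeasure_notin_sets sets_fibre_counting)
  qed
  show "emeasure ?\<tau> A = (INF V\<in>{V. openin Z V \<and> A \<subseteq> V \<and> V \<subseteq> U}. emeasure ?\<tau> V)"
    if A: "A \<in> sets ?\<tau>" "A \<subseteq> U" for A
  proof (rule antisym)
    show "emeasure ?\<tau> A \<le> (INF V\<in>{V. openin Z V \<and> A \<subseteq> V \<and> V \<subseteq> U}. emeasure ?\<tau> V)"
      using A by (intro INF_greatest emeasure_mono) (auto simp: sets_fibre_counting sets_borel_of_openin)
    \<comment> \<open>An open set between \<open>A\<close> and \<open>U\<close> with the same trace on the fibre as \<open>A\<close>.\<close>
    let ?W = "U - (?F - A)"
    have W: "openin Z ?W"
      using U closedin_subset_fibre[of "?F - A" u] by (intro openin_diff) auto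
    have "?W \<inter> ?F = A \<inter> ?F" using A by auto
    then have "emeasure ?\<tau> ?W = emeasure ?\<tau> A"
      using A W by (simp add: emeasure_fibre_counting sets_borel_of_openin sets_fibre_counting)
    then show "(INF V\<in>{V. openin Z V \<and> A \<subseteq> V \<and> V \<subseteq> U}. emeasure ?\<tau> V) \<le> emeasure ?\<tau> A"
      using A W by (intro INF_lower2[of ?W]) auto
  qed
  show "emeasure ?\<tau> V = (SUP K\<in>{K. compactin Z K \<and> K \<subseteq> V}. emeasure ?\<tau> K)" (is "_ = ?S")
    if V: "openin Z V \<and> V \<subseteq> U" for V
  proof (rule antisym)
    have Vs: "V \<in> sets (borel_of Z)" using V by (simp add: sets_borel_of_openin)
    show "?S \<le> emeasure ?\<tau> V"
      using Vs by (intro SUP_least emeasure_mono) (auto simp: sets_fibre_counting)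
    have fin: "of_nat (card T) \<le> ?S" if T: "finite T" "T \<subseteq> V \<inter> ?F" for T
    proof -
      have "compactin Z T" using T by (intro finite_imp_compactin) (auto simp: fibre_def)
      moreover have "emeasure ?\<tau> T = of_nat (card T)"
        using T fibre_subset_borel[of T u] by (simp add: emeasure_fibre_counting Int_absorb2)
      ultimately show ?thesis using T by (intro SUP_upper2[of T]) auto
    qed
    show "emeasure ?\<tau> V \<le> ?S"
    proof (cases "finite (V \<inter> ?F)")
      case True
      then show ?thesis using fin[of "V \<inter> ?F"] Vs by (simp add: emeasure_fibre_counting)
    next
      case False
      have "?S = \<infinity>"
      proof (rule ccontr)
        assume "?S \<noteq> \<infinity>"
        then obtain n where n: "?S < of_nat n"
          using ennreal_Ex_less_of_nat by (metis infinity_ennreal_def less_top)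
        obtain T where "T \<subseteq> V \<inter> ?F" "finite T" "card T = n"
          using infinite_arbitrarily_large[OF False] by blast
        then show False using fin[of T] n by simp
      qed
      then show ?thesis by (simp only: infinity_ennreal_def top_greatest)
    qed
  qed
qed

end

section \<open>Fibre measures along a local homeomorphism\<close>

text \<open>The function is built on the locally compact Hausdorff base, where Urysohn functions exist, and
pulled back along \<open>p\<close> to the image of a local section; its support lies in the image under that
section of a compact subset of the base.\<close>

lemma (in etale_map) bump_function:
  assumes lc: "locally_compact_space Y" and x: "x \<in> topspace Z"
  obtains U g where "section_image Z Y p U" and "x \<in> U" and "g \<in> ext_Cc Z" and "g x = 1"
    and "continuous_map (subtopology Z U) euclidean g" and "\<And>z. z \<notin> U \<Longrightarrow> g z = 0"
proof -
  obtain U where U: "section_image Z Y p U" and xU: "x \<in> U"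
    using local_homeomorphismD(3)[OF local_homeo x] by blast
  have oU: "openin Z U" and opU: "openin Y (p ` U)"
    using section_imageD(1,2)[OF U] by auto
  obtain \<sigma> where c\<sigma>: "continuous_map (subtopology Y (p ` U)) (subtopology Z U) \<sigma>"
    and \<sigma>: "\<And>y. y \<in> p ` U \<Longrightarrow> \<sigma> y \<in> U \<and> p (\<sigma> y) = y" "\<And>x. x \<in> U \<Longrightarrow> \<sigma> (p x) = x"
    using section_imageD(4)[OF U] by blast
  have UZ: "U \<subseteq> topspace Z" using oU by (rule openin_subset)
  have "neighbourhood_base_of (compactin Y) Y"
    using lc base_Hausdorff locally_compact_space_neighbourhood_base by blast
  then obtain V C where V: "openin Y V" and C: "compactin Y C"
    and VC: "p x \<in> V" "V \<subseteq> C" "C \<subseteq> p ` U"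
    using opU xU unfolding neighbourhood_base_of by (metis imageI)
  have "completely_regular_space Y"
    using lc base_Hausdorff by (intro locally_compact_regular_imp_completely_regular_space) auto
  moreover have "closedin Y (topspace Y - V)" "p x \<in> topspace Y - (topspace Y - V)"
    using V VC openin_subset[OF V] by auto
  ultimately obtain \<theta> :: "'y \<Rightarrow> real" where \<theta>: "continuous_map Y (top_of_set {0..1}) \<theta>"
    and \<theta>x: "\<theta> (p x) = 0" and \<theta>1: "\<theta> ` (topspace Y - V) \<subseteq> {1}"
    unfolding completely_regular_space_def by blast
  define g where "g z = (if z \<in> U then complex_of_real (1 - \<theta> (p z)) else 0)" for z
  have "continuous_map Y euclideanreal \<theta>"
    using \<theta> by (simp add: continuous_map_in_subtopology)
  then have "continuous_map Z euclideanreal (\<theta> \<circ> p)"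
    using continuous_p continuous_map_compose by blast
  then have "continuous_map (subtopology Z U) euclideanreal (\<theta> \<circ> p)"
    by (rule continuous_map_from_subtopology)
  then have "continuous_map (subtopology Z U) euclidean (\<lambda>z. complex_of_real (1 - \<theta> (p z)))"
    unfolding continuous_map_atin limitin_canonical_iff o_def
    by (intro ballI tendsto_of_real tendsto_diff tendsto_const) auto
  then have cg: "continuous_map (subtopology Z U) euclidean g"
    by (rule continuous_map_eq) (simp add: g_def)
  let ?S = "subtopology Z U"
  have pZY: "p z \<in> topspace Y" if "z \<in> topspace Z" for z
    using continuous_p that by (auto simp: continuous_map_def)
  have supp: "{z \<in> U. g z \<noteq> 0} \<subseteq> \<sigma> ` C"
  proof
    fix z assume z: "z \<in> {z \<in> U. g z \<noteq> 0}"
    then have "\<theta> (p z) \<noteq> 1" by (auto simp: g_def)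
    then have "p z \<in> C" using \<theta>1 VC(2) pZY[of z] UZ z by blast
    then show "z \<in> \<sigma> ` C" using \<sigma>(2)[of z] z by force
  qed
  have "compactin (subtopology Y (p ` U)) C"
    using C VC(3) by (simp add: compactin_subtopology)
  then have comp: "compactin ?S (\<sigma> ` C)"
    using c\<sigma> image_compactin by blast
  moreover have Ha: "Hausdorff_space ?S" using U by (rule Hausdorff_section_image)
  ultimately have "closedin ?S (\<sigma> ` C)" by (simp add: compactin_imp_closedin)
  then have "?S closure_of {z \<in> U. g z \<noteq> 0} \<subseteq> \<sigma> ` C"
    using supp by (intro closure_of_minimal)
  then have "compactin ?S (?S closure_of {z \<in> U. g z \<noteq> 0})"
    using comp by (intro closed_compactin[OF comp]) auto
  then have "g \<in> ext_Cc Z"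
    unfolding ext_Cc_def using oU Ha cg by (intro CollectI exI[of _ U]) (simp add: g_def)
  moreover have "g x = 1" using \<theta>x xU by (simp add: g_def)
  ultimately show ?thesis using U xU cg by (intro that[of U g]) (auto simp: g_def)
qed

text \<open>Local compactness of the base supplies the bump functions that detect how the masses of the
points vary; full support ensures that these masses can serve as denominators.\<close>

locale full_fibre_measures = etale_map +
  fixes lam :: "'y \<Rightarrow> 'z measure"
  assumes base_locally_compact: "locally_compact_space Y"
    and continuous_family: "continuous_family Z Y p lam"
    and full_support: "full_support Z Y p lam"
begin

definition point_mass :: "'z \<Rightarrow> real" where
  "point_mass x = measure (lam (p x)) {x}"

lemma p_in_base: "x \<in> topspace Z \<Longrightarrow> p x \<in> topspace Y"
  using continuous_p by (auto simp: continuous_map_def)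

context
  fixes u assumes u: "u \<in> topspace Y"
begin

lemma radon_lam: "radon_measure Z (lam u)" and sigma_finite_lam: "sigma_finite_measure (lam u)"
  and AE_lam: "AE x in lam u. p x = u"
  using continuous_family u by (auto simp: continuous_family_def)

lemma sets_lam: "sets (lam u) = sets (borel_of Z)"
  using radon_lam by (simp add: radon_measure_def)

lemma space_lam: "space (lam u) = topspace Z"
  using sets_eq_imp_space_eq[OF sets_lam] by (simp add: space_borel_of)

lemma borel_measurable_lam: "borel_measurable (lam u) = borel_measurable (borel_of Z)"
  by (rule measurable_cong_sets[OF sets_lam refl])

lemma off_fibre_null: "topspace Z - fibre Z p u \<in> null_sets (lam u)"
proof -
  have eq: "{x \<in> space (lam u). \<not> p x = u} = topspace Z - fibre Z p u"
    by (auto simp: space_lam fibre_def)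
  have "topspace Z - fibre Z p u \<in> sets (lam u)"
    unfolding sets_lam using closedin_fibre by (intro sets_borel_of_openin) (simp add: openin_diff)
  then show ?thesis
    using AE_lam AE_iff_null[of "lam u" "\<lambda>x. p x = u"] by (simp add: eq)
qed

lemma emeasure_lam_fibre:
  assumes A: "A \<in> sets (borel_of Z)"
  shows "emeasure (lam u) A = emeasure (lam u) (A \<inter> fibre Z p u)"
proof -
  have "A \<subseteq> topspace Z" using sets.sets_into_space[OF A] by (simp add: space_borel_of)
  then have eq: "A - (topspace Z - fibre Z p u) = A \<inter> fibre Z p u" by auto
  show ?thesis
    using emeasure_Diff_null_set[OF off_fibre_null, of A] A by (simp add: eq sets_lam)
qed

text \<open>A neighbourhood of \<open>x\<close> that isolates it in its fibre has the same measure as \<open>{x}\<close>, and full support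
makes that measure nonzero.  Finiteness holds because \<open>{x}\<close> is compact.\<close>

lemma point_mass_bounds:
  assumes x: "x \<in> fibre Z p u"
  shows "emeasure (lam u) {x} \<noteq> 0" and "emeasure (lam u) {x} < \<infinity>"
proof -
  have xZ: "x \<in> topspace Z" and px: "p x = u" using x by (auto simp: fibre_def)
  obtain U where U: "section_image Z Y p U" "x \<in> U" "U \<inter> fibre Z p (p x) = {x}"
    using fibre_isolated[OF xZ] by blast
  have oU: "openin Z U" using section_imageD(1)[OF U(1)] .
  have "x \<in> measure_supp Z (lam u)"
    using full_support u x by (simp add: full_support_def)
  then have "emeasure (lam u) U \<noteq> 0"
    using oU U(2) by (auto simp: measure_supp_def)
  then show "emeasure (lam u) {x} \<noteq> 0"
    using emeasure_lam_fibre[OF sets_borel_of_openin[OF oU]] U(3) px by simp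
  have "compactin Z {x}" using xZ by simp
  then show "emeasure (lam u) {x} < \<infinity>"
    using radon_lam oU U(2) Hausdorff_section_image[OF U(1)] unfolding radon_measure_def by blast
qed

lemma emeasure_singleton_lam:
  "x \<in> fibre Z p u \<Longrightarrow> emeasure (lam u) {x} = ennreal (point_mass x)"
  using point_mass_bounds(2)[of x] unfolding point_mass_def
  by (simp add: fibre_def emeasure_eq_ennreal_measure)

text \<open>A set of finite measure contains only countably many atoms, and every point of the fibre is one.\<close>

lemma countable_fibre: "countable (fibre Z p u)"
proof -
  obtain A :: "nat \<Rightarrow> 'z set" where A: "range A \<subseteq> sets (lam u)" "(\<Union>i. A i) = space (lam u)"
    "\<And>i. emeasure (lam u) (A i) \<noteq> \<infinity>"
    using sigma_finite_measure.sigma_finite[OF sigma_finite_lam] by metis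
  have "countable (A i \<inter> fibre Z p u)" for i
  proof -
    let ?R = "restrict_space (lam u) (A i)"
    have Ai: "A i \<in> sets (lam u)" using A(1) by auto
    then have As: "A i \<inter> space (lam u) = A i" by (simp add: sets.Int_space_eq2)
    have "finite_measure ?R"
    proof (rule finite_measureI)
      have "emeasure ?R (space ?R) = emeasure (lam u) (A i)"
        using Ai As by (simp add: space_restrict_space emeasure_restrict_space)
      then show "emeasure ?R (space ?R) \<noteq> \<infinity>" using A(3)[of i] by simp
    qed
    then have "countable {x. measure ?R {x} \<noteq> 0}" by (rule finite_measure.countable_support)
    moreover have "A i \<inter> fibre Z p u \<subseteq> {x. measure ?R {x} \<noteq> 0}"
    proof clarify
      fix x assume x: "x \<in> A i" "x \<in> fibre Z p u" and "measure ?R {x} = 0"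
      then have "measure (lam u) {x} = 0"
        using Ai As by (simp add: measure_restrict_space)
      then show False
        using point_mass_bounds[OF x(2)] by (simp add: measure_def enn2real_eq_0_iff)
    qed
    ultimately show ?thesis by (rule countable_subset[rotated])
  qed
  moreover have "fibre Z p u = (\<Union>i. A i \<inter> fibre Z p u)"
    using A(2) by (auto simp: space_lam fibre_def)
  ultimately show ?thesis by (metis countable_UN countableI_type)
qed

text \<open>The set \<open>U\<close> meets the fibre over \<open>u\<close> only in \<open>x\<close>, so almost everywhere \<open>g\<close> is \<open>g x\<close> times the
indicator of \<open>{x}\<close>.\<close>

lemma integral_lam_section:
  fixes g :: "'z \<Rightarrow> complex"
  assumes U: "section_image Z Y p U" and x: "x \<in> U" "p x = u"
    and g: "g \<in> borel_measurable (borel_of Z)" "\<And>z. z \<notin> U \<Longrightarrow> g z = 0"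
  shows "(LINT z|lam u. g z) = point_mass x *\<^sub>R g x"
proof -
  have xF: "x \<in> fibre Z p u" 
    using x openin_subset[OF section_imageD(1)[OF U]] by (auto simp: fibre_def)
  then have sx: "{x} \<in> sets (lam u)"
    using singleton_borel by (simp add: sets_lam fibre_def)
  have "AE z in lam u. g z = indicator {x} z *\<^sub>R g x"
  proof (rule AE_mp[OF AE_lam], rule AE_I2, rule impI)
    fix z assume "p z = u"
    then have "z = x" if "z \<in> U"
      using inj_onD[OF section_imageD(3)[OF U], of z x] x that by simp
    then show "g z = indicator {x} z *\<^sub>R g x"
      using g(2)[of z] x(1) by (cases "z \<in> U") (auto simp: indicator_def)
  qed
  then have "(LINT z|lam u. g z) = (LINT z|lam u. indicator {x} z *\<^sub>R g x)"
    using g(1) sx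
    by (intro integral_cong_AE borel_measurable_scaleR borel_measurable_indicator)
      (auto simp: borel_measurable_lam)
  also have "\<dots> = measure (lam u) {x} *\<^sub>R g x"
    using has_bochner_integral_indicator[OF sx point_mass_bounds(2)[OF xF]]
    by (rule has_bochner_integral_integral_eq)
  finally show ?thesis using x(2) by (simp add: point_mass_def)
qed

end

lemma point_mass_pos: "x \<in> topspace Z \<Longrightarrow> 0 < point_mass x"
  using point_mass_bounds[OF p_in_base, of x x] emeasure_singleton_lam[OF p_in_base, of x x]
  by (auto simp: fibre_def ennreal_eq_0_iff not_le)

text \<open>Near \<open>x\<close>, with \<open>g\<close> a bump function at \<open>x\<close>, the weight is the quotient of the two continuous functions
\<open>z \<mapsto> \<integral> g d(lam (p z))\<close> and \<open>g\<close>.\<close>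

lemma continuous_point_mass: "continuous_map Z euclideanreal point_mass"
proof (rule continuous_map_if_locally_continuous)
  fix x assume x: "x \<in> topspace Z"
    obtain U g where U: "section_image Z Y p U" and xU: "x \<in> U" and g: "g \<in> ext_Cc Z"
      and gx: "g x = 1" and cg: "continuous_map (subtopology Z U) euclidean g"
      and g0: "\<And>z. z \<notin> U \<Longrightarrow> g z = 0"
      using base_locally_compact x by (rule bump_function) (rule that)
    have oU: "openin Z U" using section_imageD(1)[OF U] .
    let ?W = "{z \<in> topspace (subtopology Z U). g z \<in> - {0}}"
    have "openin (subtopology Z U) ?W"
      using cg by (rule openin_continuous_map_preimage) auto
    then have oW: "openin Z ?W" using oU openin_trans_full by blast
    have WU: "?W \<subseteq> U" by auto
    let ?I = "\<lambda>u. LINT z|lam u. g z"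
    have "continuous_map Y euclidean ?I"
      using continuous_family g ext_Cc_subset_Cc by (auto simp: continuous_family_def)
    then have "continuous_map Z euclidean (?I \<circ> p)"
      using continuous_p continuous_map_compose by blast
    then have cI: "continuous_map (subtopology Z ?W) euclidean (?I \<circ> p)"
      by (rule continuous_map_from_subtopology)
    have cgW: "continuous_map (subtopology Z ?W) euclidean g"
      using cg WU by (rule continuous_map_from_subtopology_mono)
    have "continuous_map (subtopology Z ?W) euclidean (\<lambda>z. (?I \<circ> p) z / g z)"
      using cI cgW by (rule continuous_map_complex_divide) simp
    then have "continuous_map (subtopology Z ?W) euclidean (\<lambda>z. Re ((?I \<circ> p) z / g z))"
      unfolding continuous_map_atin limitin_canonical_iff by (intro ballI tendsto_Re) blast
    moreover have "Re ((?I \<circ> p) z / g z) = point_mass z" if "z \<in> topspace (subtopology Z ?W)" for z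
    proof -
      have z: "z \<in> U" "g z \<noteq> 0" "z \<in> topspace Z" using that by auto
      have "?I (p z) = point_mass z *\<^sub>R g z"
        using p_in_base[OF z(3)] U z(1) refl _ g0
        by (rule integral_lam_section) (use ext_Cc_borel_compact_support[OF g] in blast)
      then show ?thesis using z(2) by (simp add: scaleR_conv_of_real)
    qed
    ultimately have "continuous_map (subtopology Z ?W) euclideanreal point_mass"
      by (rule continuous_map_eq)
    moreover have "x \<in> ?W" using x xU gx by simp
    ultimately show "\<exists>W. openin Z W \<and> x \<in> W \<and>
        continuous_map (subtopology Z W) euclideanreal point_mass"
      using oW by (intro exI[of _ ?W]) simp
qed

lemma borel_measurable_point_mass: "point_mass \<in> borel_measurable (borel_of Z)"
  using continuous_map_measurable_borel_of[OF continuous_point_mass] by (simp add: borel_of_euclidean)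

text \<open>Both measures are concentrated on a countable fibre and agree on its points.\<close>

lemma lam_eq_density:
  assumes u: "u \<in> topspace Y"
  shows "lam u = density (fibre_counting Z p u) (\<lambda>x. ennreal (point_mass x))"
proof (rule measure_eqI)
  let ?F = "fibre Z p u" and ?\<tau> = "fibre_counting Z p u"
  show "sets (lam u) = sets (density ?\<tau> (\<lambda>x. ennreal (point_mass x)))"
    using u by (simp add: sets_lam sets_fibre_counting)
  fix A assume "A \<in> sets (lam u)"
  then have A: "A \<in> sets (borel_of Z)" using u by (simp add: sets_lam)
  have m: "point_mass \<in> borel_measurable ?\<tau>"
    using borel_measurable_point_mass
    by (simp add: measurable_cong_sets[OF sets_fibre_counting refl])
  have "emeasure (density ?\<tau> (\<lambda>x. ennreal (point_mass x))) A
      = (\<integral>\<^sup>+x. ennreal (point_mass x) * indicator A x \<partial>?\<tau>)"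
    using A m by (subst emeasure_density) (auto simp: sets_fibre_counting)
  also have "\<dots> = (\<integral>\<^sup>+x. ennreal (point_mass x) * indicator A x \<partial>count_space ?F)"
    unfolding fibre_counting_def using A borel_measurable_point_mass
    by (subst nn_integral_distr[OF inclusion_measurable]) auto
  also have "\<dots> = (\<integral>\<^sup>+x. emeasure (lam u) {x} \<partial>count_space (A \<inter> ?F))"
    using emeasure_singleton_lam[OF u]
    by (auto simp: nn_integral_count_space_indicator intro!: nn_integral_cong split: split_indicator)
  also have "\<dots> = emeasure (lam u) (A \<inter> ?F)"
    using countable_fibre[OF u] singleton_borel sets_lam[OF u]
    by (intro emeasure_countable_singleton[symmetric]) (auto simp: fibre_def)
  finally show "emeasure (lam u) A = emeasure (density ?\<tau> (\<lambda>x. ennreal (point_mass x))) A"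
    using emeasure_lam_fibre[OF u A] by simp
qed

lemma integral_fibre_counting_eq_lam:
  fixes f :: "'z \<Rightarrow> complex"
  assumes u: "u \<in> topspace Y" and f: "f \<in> borel_measurable (borel_of Z)"
  shows "(LINT x|fibre_counting Z p u. f x) = (LINT x|lam u. f x / complex_of_real (point_mass x))"
proof -
  let ?\<tau> = "fibre_counting Z p u"
  have cong: "borel_measurable ?\<tau> = (borel_measurable (borel_of Z) :: ('z \<Rightarrow> 'b::topological_space) set)"
    by (rule measurable_cong_sets[OF sets_fibre_counting refl])
  have "(LINT x|lam u. f x / complex_of_real (point_mass x))
      = (LINT x|?\<tau>. point_mass x *\<^sub>R (f x / complex_of_real (point_mass x)))"
    unfolding lam_eq_density[OF u] 
  proof (rule integral_density)
    show "(\<lambda>x. f x / complex_of_real (point_mass x)) \<in> borel_measurable ?\<tau>"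
      using f borel_measurable_point_mass unfolding cong
      by (intro borel_measurable_divide) auto
    show "point_mass \<in> borel_measurable ?\<tau>"
      using borel_measurable_point_mass unfolding cong .
    show "AE x in ?\<tau>. 0 \<le> point_mass x"
      using point_mass_pos by (intro AE_I2) (auto simp: space_fibre_counting less_imp_le)
  qed
  also have "\<dots> = (LINT x|?\<tau>. f x)"
    using less_imp_neq[OF point_mass_pos, symmetric]
    by (intro Bochner_Integration.integral_cong) (simp_all add: space_fibre_counting scaleR_conv_of_real)
  finally show ?thesis ..
qed

text \<open>Continuity for the counting measures is inherited from \<open>lam\<close> by testing \<open>lam\<close> against
\<open>f / point_mass\<close>.\<close>

lemma continuous_family_fibre_counting: "continuous_family Z Y p (fibre_counting Z p)"
  unfolding continuous_family_def
proof (intro conjI ballI)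
  fix u assume u: "u \<in> topspace Y"
  show "radon_measure Z (fibre_counting Z p u)" by (rule radon_fibre_counting)
  show "sigma_finite_measure (fibre_counting Z p u)"
    using countable_fibre[OF u] by (rule sigma_finite_fibre_counting)
  show "AE x in fibre_counting Z p u. p x = u" by (rule AE_fibre_counting)
next
  fix f assume f: "f \<in> Cc Z"
  have "(\<lambda>x. f x / complex_of_real (point_mass x)) \<in> Cc Z"
    using f continuous_point_mass point_mass_pos by (intro Cc_divide_continuous) (auto simp: less_le)
  then have "continuous_map Y euclidean (\<lambda>u. LINT x|lam u. f x / complex_of_real (point_mass x))"
    using continuous_family by (auto simp: continuous_family_def)
  then show "continuous_map Y euclidean (\<lambda>u. LINT x|fibre_counting Z p u. f x)"
    by (rule continuous_map_eq)
      (simp add: integral_fibre_counting_eq_lam[OF _ Cc_borel_compact_support(1)[OF f]])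
qed

text \<open>A null set of \<open>lam u\<close> cannot contain a point of the fibre, since such points are atoms.\<close>

lemma absolutely_continuous_fibre_counting:
  assumes u: "u \<in> topspace Y"
  shows "absolutely_continuous (fibre_counting Z p u) (lam u)"
    and "absolutely_continuous (lam u) (fibre_counting Z p u)"
proof -
  have m: "point_mass \<in> borel_measurable (fibre_counting Z p u)"
    using borel_measurable_point_mass
    by (simp add: measurable_cong_sets[OF sets_fibre_counting refl])
  then show "absolutely_continuous (fibre_counting Z p u) (lam u)"
    unfolding lam_eq_density[OF u] by (intro absolutely_continuousI_density) simp
  show "absolutely_continuous (lam u) (fibre_counting Z p u)"
    unfolding absolutely_continuous_def
  proof
    fix A assume A: "A \<in> null_sets (lam u)"
    then have sA: "A \<in> sets (borel_of Z)" using sets_lam[OF u] by (auto simp: null_sets_def)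
    have False if x: "x \<in> A" "x \<in> fibre Z p u" for x
    proof -
      have "emeasure (lam u) {x} \<le> emeasure (lam u) A"
        using x A by (intro emeasure_mono) (auto simp: null_sets_def)
      then show False using A point_mass_bounds(1)[OF u x(2)] by (simp add: null_sets_def)
    qed
    then have "A \<inter> fibre Z p u = {}" by blast
    then show "A \<in> null_sets (fibre_counting Z p u)"
      using sA by (simp add: null_sets_def sets_fibre_counting emeasure_fibre_counting)
  qed
qed

lemma RN_deriv_fibre_counting:
  assumes u: "u \<in> topspace Y"
  shows "AE x in fibre_counting Z p u.
           RN_deriv (fibre_counting Z p u) (lam u) x = ennreal (point_mass x)"
proof -
  interpret \<tau>: sigma_finite_measure "fibre_counting Z p u"
    using countable_fibre[OF u] by (rule sigma_finite_fibre_counting)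
  have "(\<lambda>x. ennreal (point_mass x)) \<in> borel_measurable (fibre_counting Z p u)"
    using borel_measurable_point_mass
    by (simp add: measurable_cong_sets[OF sets_fibre_counting refl])
  from \<tau>.RN_deriv_unique[OF this lam_eq_density[OF u, symmetric]] show ?thesis
    by (rule AE_mp) simp
qed

end

section \<open>Iterated sums over fibres\<close>

text \<open>Fubini for counting measures.  The fibre of \<open>(a, x) \<mapsto> p x\<close> over \<open>u\<close> meets \<open>K\<close> in a finite set, so
the iterated sum can be regrouped.  The outer integral is over a Borel measure on \<open>Z\<close>, and
hence requires the inner sum to be Borel on all of \<open>Z\<close> and not just on the fibre.\<close>

lemma iterated_integral_fibre_counting:
  fixes h :: "'a \<times> 'z \<Rightarrow> complex"
  assumes A: "etale_map A B r" and Z: "etale_map Z Y p" and q: "continuous_map Z B q"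
    and h: "h \<in> borel_measurable (borel_of (fibre_product A Z r q))"
    and K: "compactin (fibre_product A Z r q) K"
    and h0: "\<And>e. e \<in> topspace (fibre_product A Z r q) \<Longrightarrow> e \<notin> K \<Longrightarrow> h e = 0"
  shows "(LINT x|fibre_counting Z p u.
            (LINT a:fibre A r (q x)|fibre_counting A r (q x). h (a, x)))
       = (\<Sum>e | e \<in> K \<and> p (snd e) = u. h e)"
proof -
  interpret A: etale_map A B r by (rule A)
  interpret Z: etale_map Z Y p by (rule Z)
  let ?E = "fibre_product A Z r q"
  let ?S = "\<lambda>x. {e. e \<in> K \<and> snd e = x}"
  have lh: "local_homeomorphism ?E Z snd"
    using A.local_homeo q by (rule local_homeomorphism_pullback)
  have KE: "K \<subseteq> topspace ?E" using K by (rule compactin_subset_topspace)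
  have finS: "finite (?S x)" for x
    using finite_fibre_in_compact[OF lh K, of x] by simp
  have inner: "(LINT a:fibre A r (q x)|fibre_counting A r (q x). h (a, x)) = (\<Sum>e\<in>?S x. h e)"
    if x: "x \<in> topspace Z" for x
  proof -
    have "(LINT a:fibre A r (q x)|fibre_counting A r (q x). h (a, x)) = (\<Sum>a\<in>fst ` ?S x. h (a, x))"
    proof (rule A.set_integral_fibre_counting_finite_support)
      show "finite (fst ` ?S x)" using finS by simp
      show "fst ` ?S x \<subseteq> fibre A r (q x)"
        using KE by (auto simp: topspace_fibre_product fibre_def)
      fix a assume a: "a \<in> fibre A r (q x)" "a \<notin> fst ` ?S x"
      then have "(a, x) \<in> topspace ?E" using x by (auto simp: topspace_fibre_product fibre_def)
      moreover have "(a, x) \<notin> K" using a(2) by force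
      ultimately show "h (a, x) = 0" by (rule h0)
    qed
    also have "\<dots> = (\<Sum>e\<in>?S x. h (fst e, x))"
      by (subst sum.reindex) (auto simp: inj_on_def)
    also have "\<dots> = (\<Sum>e\<in>?S x. h e)"
      by (intro sum.cong) auto
    finally show ?thesis .
  qed
  have pK: "compactin Z (snd ` K)"
    using K continuous_map_fibre_product_projections(2) by (rule image_compactin)
  let ?T = "{x \<in> snd ` K. p x = u}"
  have finT: "finite ?T"
    using Z.local_homeo pK by (rule finite_fibre_in_compact)
  let ?Ku = "{e. e \<in> K \<and> p (snd e) = u}"
  have "?Ku = (\<Union>x\<in>?T. ?S x)" by auto
  then have finK: "finite ?Ku" using finT finS by simp
  have "(LINT x|fibre_counting Z p u.
            (LINT a:fibre A r (q x)|fibre_counting A r (q x). h (a, x)))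
      = (LINT x|fibre_counting Z p u. (\<Sum>e\<in>?S x. h e))"
    using inner by (intro Bochner_Integration.integral_cong) (simp_all add: Z.space_fibre_counting)
  also have "\<dots> = (\<Sum>x\<in>?T. \<Sum>e\<in>?S x. h e)"
  proof (rule Z.integral_fibre_counting_finite_support)
    show "(\<lambda>x. \<Sum>e\<in>?S x. h e) \<in> borel_measurable (borel_of Z)"
      using lh K h h0 by (rule borel_measurable_fibre_sum)
    show "finite ?T" by (rule finT)
    show "?T \<subseteq> fibre Z p u"
      using compactin_subset_topspace[OF pK] by (auto simp: fibre_def)
    fix x assume x: "x \<in> fibre Z p u" "x \<notin> ?T"
    then have "?S x = {}" by (auto simp: fibre_def image_iff)
    then show "(\<Sum>e\<in>?S x. h e) = 0" by (simp only: sum.empty)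
  qed
  also have "\<dots> = (\<Sum>x\<in>?T. \<Sum>e | e \<in> ?Ku \<and> snd e = x. h e)"
    by (intro sum.cong) auto
  also have "\<dots> = (\<Sum>e\<in>?Ku. h e)"
    using finK finT by (intro sum.group) auto
  finally show ?thesis .
qed

text \<open>The right-hand side does not mention \<open>\<Phi>\<close>.  Two homeomorphisms onto \<open>L\<close> that respect the
projection to \<open>Y\<close> therefore give the same iterated integral.\<close>

lemma iterated_integral_fibre_counting_reparametrise:
  fixes F :: "'l \<times> 'z \<Rightarrow> complex"
  assumes A: "etale_map A B r" and Z: "etale_map Z Y p" and q: "continuous_map Z B q"
    and \<Phi>: "continuous_map (fibre_product A Z r q) L \<Phi>"
    and \<Psi>: "continuous_map L (fibre_product A Z r q) \<Psi>"
    and \<Psi>\<Phi>: "\<And>e. e \<in> topspace (fibre_product A Z r q) \<Longrightarrow> \<Psi> (\<Phi> e) = e"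
    and \<Phi>\<Psi>: "\<And>k. k \<in> topspace L \<Longrightarrow> \<Phi> (\<Psi> k) = k"
    and p\<Psi>: "\<And>k. k \<in> topspace L \<Longrightarrow> p (snd (\<Psi> k)) = p (snd k)"
    and F: "F \<in> borel_measurable (borel_of L)" and K: "compactin L K"
    and F0: "\<And>k. k \<notin> K \<Longrightarrow> F k = 0"
  shows "(LINT x|fibre_counting Z p u.
            (LINT a:fibre A r (q x)|fibre_counting A r (q x). F (\<Phi> (a, x))))
       = (\<Sum>k | k \<in> K \<and> p (snd k) = u. F k)"
proof -
  let ?E = "fibre_product A Z r q"
  have KL: "K \<subseteq> topspace L" using K by (rule compactin_subset_topspace)
  have "(LINT x|fibre_counting Z p u.
            (LINT a:fibre A r (q x)|fibre_counting A r (q x). F (\<Phi> (a, x))))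
      = (\<Sum>e | e \<in> \<Psi> ` K \<and> p (snd e) = u. F (\<Phi> e))"
  proof (rule iterated_integral_fibre_counting[OF A Z q])
    show "(\<lambda>e. F (\<Phi> e)) \<in> borel_measurable (borel_of ?E)"
      using continuous_map_measurable_borel_of[OF \<Phi>] F by (rule measurable_compose)
    show "compactin ?E (\<Psi> ` K)" using K \<Psi> by (rule image_compactin)
    fix e assume "e \<in> topspace ?E" "e \<notin> \<Psi> ` K"
    then have "\<Phi> e \<notin> K" using \<Psi>\<Phi>[of e] by (metis image_eqI)
    then show "F (\<Phi> e) = 0" by (rule F0)
  qed
  also have "{e. e \<in> \<Psi> ` K \<and> p (snd e) = u} = \<Psi> ` {k. k \<in> K \<and> p (snd k) = u}"
    using p\<Psi> KL by auto
  also have "(\<Sum>e\<in>\<Psi> ` {k. k \<in> K \<and> p (snd k) = u}. F (\<Phi> e))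
      = (\<Sum>k | k \<in> K \<and> p (snd k) = u. F (\<Phi> (\<Psi> k)))"
  proof (rule sum.reindex[unfolded o_def])
    show "inj_on \<Psi> {k. k \<in> K \<and> p (snd k) = u}"
      using \<Phi>\<Psi> KL by (intro inj_on_inverseI[of _ \<Phi>]) auto
  qed
  also have "\<dots> = (\<Sum>k | k \<in> K \<and> p (snd k) = u. F k)"
    using \<Phi>\<Psi> KL by (intro sum.cong) auto
  finally show ?thesis .
qed

section \<open>Bispaces\<close>

lemma (in topological_groupoid) topspace_unit_top: "topspace (unit_top G) = units G"
  using rng_closed by (auto simp: unit_top_def units_def arrows_def)

text \<open>Expand \<open>(g\<inverse>)\<inverse>\<close> as \<open>(g\<inverse>)\<inverse> (g\<inverse> g)\<close> and reassociate.\<close>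

lemma (in groupoid) inv_inv:
  assumes g: "g \<in> arrows G"
  shows "ginv G (ginv G g) = g"
proof -
  let ?i = "ginv G g" and ?j = "ginv G (ginv G g)"
  have i: "?i \<in> arrows G" and j: "?j \<in> arrows G" using g by (auto intro: inv_closed)
  have "?j = gmul G ?j (gmul G ?i g)"
    using mul_unit_right[OF j] g i by (simp add: src_inv rng_inv mul_inv_left)
  also have "\<dots> = gmul G (gmul G ?j ?i) g"
    using g i j by (intro mul_assoc[symmetric]) (simp_all add: src_inv rng_inv)
  also have "\<dots> = g"
    using mul_unit_left[OF g] g i by (simp add: mul_inv_left src_inv)
  finally show ?thesis .
qed

context bispace
begin

lemma ract_closed:
  assumes "x \<in> bs_points X" and "h \<in> arrows H" and "rmom X x = rng H h"
  shows "ract X x h \<in> bs_points X"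
proof -
  have "(x, h) \<in> topspace (right_prod_top H X)"
    using assms by (auto simp: right_prod_top_def bs_points_def arrows_def)
  then show ?thesis
    using continuous_ract by (auto simp: continuous_map_def bs_points_def dest: funcset_mem)
qed

lemma ract_inv_cancel:
  assumes "x \<in> bs_points X" and "h \<in> arrows H" and "rmom X x = rng H h"
  shows "ract X (ract X x h) (ginv H h) = x"
proof -
  have "ract X (ract X x h) (ginv H h) = ract X x (gmul H h (ginv H h))"
    using assms by (intro ract_mul[symmetric]) (simp_all add: H.inv_closed H.rng_inv)
  also have "\<dots> = x"
    using assms ract_unit[of x] by (simp add: H.mul_inv_right)
  finally show ?thesis .
qed

lemma ract_cancel_inv:
  assumes "x \<in> bs_points X" and "h \<in> arrows H" and "rmom X x = src H h"
  shows "ract X (ract X x (ginv H h)) h = x"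
  using ract_inv_cancel[of x "ginv H h"] assms by (simp add: H.inv_closed H.rng_inv H.inv_inv)

lemma lact_inv_cancel:
  assumes "g \<in> arrows G" and "x \<in> bs_points X" and "src G g = lmom X x"
  shows "lact X (ginv G g) (lact X g x) = x"
proof -
  have "lact X (ginv G g) (lact X g x) = lact X (gmul G (ginv G g) g) x"
    using assms by (intro lact_mul[symmetric]) (simp_all add: G.inv_closed G.src_inv)
  also have "\<dots> = x"
    using assms lact_unit[of x] by (simp add: G.mul_inv_left)
  finally show ?thesis .
qed

lemma lact_cancel_inv:
  assumes "g \<in> arrows G" and "x \<in> bs_points X" and "rng G g = lmom X x"
  shows "lact X g (lact X (ginv G g) x) = x"
  using lact_inv_cancel[of "ginv G g" x] assms by (simp add: G.inv_closed G.src_inv G.inv_inv)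

lemma left_prod_top_eq_fibre_product:
  "left_prod_top G X = fibre_product (arr_top G) (bs_top X) (src G) (lmom X)"
  by (simp add: left_prod_top_def fibre_product_def)

text \<open>Translation by \<open>\<eta>\<close> is a bijection from the fibre over \<open>rng H \<eta>\<close> to the fibre over \<open>src H \<eta>\<close>.\<close>

lemma right_invariant_fibre_counting:
  assumes "etale_map (bs_top X) (unit_top H) (rmom X)"
  shows "right_invariant H X (fibre_counting (bs_top X) (rmom X))"
  unfolding right_invariant_def
proof (intro ballI)
  interpret etale_map "bs_top X" "unit_top H" "rmom X" by (rule assms)
  fix \<eta> f assume \<eta>: "\<eta> \<in> arrows H" and f: "f \<in> Cc (bs_top X)"
  obtain K where K: "compactin (bs_top X) K" and f0: "\<And>x. x \<notin> K \<Longrightarrow> f x = 0"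
    using Cc_borel_compact_support(2)[OF f] by blast
  let ?T = "{y \<in> K. rmom X y = src H \<eta>}"
    and ?S = "(\<lambda>y. ract X y (ginv H \<eta>)) ` {y \<in> K. rmom X y = src H \<eta>}"
  have finT: "finite ?T" using local_homeo K by (rule finite_fibre_in_compact)
  have KX: "y \<in> bs_points X" if "y \<in> K" for y
    using compactin_subset_topspace[OF K] that by (auto simp: bs_points_def)
  have fibre: "x \<in> fibre (bs_top X) (rmom X) v \<longleftrightarrow> x \<in> bs_points X \<and> rmom X x = v" for x v
    by (simp add: fibre_def bs_points_def)
  have "(LINT x:fibre (bs_top X) (rmom X) (rng H \<eta>)|fibre_counting (bs_top X) (rmom X) (rng H \<eta>).
          f (ract X x \<eta>)) = (\<Sum>x\<in>?S. f (ract X x \<eta>))"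
  proof (rule set_integral_fibre_counting_finite_support)
    show "finite ?S" using finT by simp
    show "?S \<subseteq> fibre (bs_top X) (rmom X) (rng H \<eta>)"
      using KX \<eta> by (auto simp: fibre H.inv_closed H.rng_inv H.src_inv rmom_ract intro!: ract_closed)
    fix x assume x: "x \<in> fibre (bs_top X) (rmom X) (rng H \<eta>)" "x \<notin> ?S"
    then have xX: "x \<in> bs_points X" "rmom X x = rng H \<eta>" by (simp_all add: fibre)
    have "ract X x \<eta> \<notin> K"
    proof
      assume "ract X x \<eta> \<in> K"
      then have "ract X x \<eta> \<in> ?T" using rmom_ract[OF xX(1) \<eta> xX(2)] by simp
      then show False using x(2) ract_inv_cancel[OF xX(1) \<eta> xX(2)] by force
    qed
    then show "f (ract X x \<eta>) = 0" by (rule f0)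
  qed
  also have "\<dots> = (\<Sum>y\<in>?T. f (ract X (ract X y (ginv H \<eta>)) \<eta>))"
  proof (rule sum.reindex[unfolded o_def])
    show "inj_on (\<lambda>y. ract X y (ginv H \<eta>)) ?T"
      using KX \<eta> by (intro inj_on_inverseI[of _ "\<lambda>x. ract X x \<eta>"]) (auto simp: ract_cancel_inv)
  qed
  also have "\<dots> = (\<Sum>y\<in>?T. f y)"
    using KX \<eta> by (intro sum.cong) (auto simp: ract_cancel_inv)
  also have "\<dots> = (LINT x|fibre_counting (bs_top X) (rmom X) (src H \<eta>). f x)"
    using Cc_borel_compact_support(1)[OF f] finT KX f0
    by (intro integral_fibre_counting_finite_support[symmetric]) (auto simp: fibre)
  finally show "(LINT x:fibre (bs_top X) (rmom X) (rng H \<eta>)|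
      fibre_counting (bs_top X) (rmom X) (rng H \<eta>). f (ract X x \<eta>))
      = (LINT x|fibre_counting (bs_top X) (rmom X) (src H \<eta>). f x)" .
qed

text \<open>The maps \<open>(\<gamma>, x) \<mapsto> (\<gamma>\<inverse>, x)\<close> and \<open>(\<gamma>, x) \<mapsto> (\<gamma>, \<gamma>\<inverse>x)\<close> are two homeomorphisms from
\<open>{(\<gamma>, x). rng \<gamma> = lmom x}\<close> to \<open>{(g, y). src g = lmom y}\<close>, and both respect the right momentum map
because it is invariant under \<open>G\<close>.  The two sides of the adjoining identity are the corresponding
iterated integrals of \<open>F\<close>.\<close>

lemma adjoining_function_fibre_counting:
  assumes Ga: "etale_map (arr_top G) (unit_top G) (rng G)"
    and Xa: "etale_map (bs_top X) (unit_top H) (rmom X)"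
  shows "adjoining_function G (haar_counting G) H X (fibre_counting (bs_top X) (rmom X)) (\<lambda>_. 1)"
  unfolding adjoining_function_def
proof (intro conjI ballI)
  let ?L = "left_prod_top G X"
  let ?E = "fibre_product (arr_top G) (bs_top X) (rng G) (lmom X)"
  have tL: "k \<in> topspace ?L \<longleftrightarrow>
      fst k \<in> arrows G \<and> snd k \<in> bs_points X \<and> src G (fst k) = lmom X (snd k)" for k
    by (auto simp: left_prod_top_eq_fibre_product topspace_fibre_product arrows_def bs_points_def
        split: prod.splits)
  have tE: "e \<in> topspace ?E \<longleftrightarrow>
      fst e \<in> arrows G \<and> snd e \<in> bs_points X \<and> rng G (fst e) = lmom X (snd e)" for e
    by (auto simp: topspace_fibre_product arrows_def bs_points_def split: prod.splits)
  \<comment> \<open>The formula \<open>?\<Phi>1\<close> serves in both directions, as inversion of arrows is an involution.\<close>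
  let ?\<Phi>1 = "\<lambda>e. (ginv G (fst e), snd e)"
  let ?\<Phi>2 = "\<lambda>e. (fst e, lact X (ginv G (fst e)) (snd e))"
  let ?\<Psi>2 = "\<lambda>k. (fst k, lact X (fst k) (snd k))"
  have inv_fst: "continuous_map (fibre_product (arr_top G) (bs_top X) a b) (arr_top G)
      (\<lambda>e. ginv G (fst e))" for a b :: "_ \<Rightarrow> 'g"
    using continuous_map_compose[OF continuous_map_fibre_product_projections(1) G.continuous_inv]
    by (simp add: o_def)
  have \<Phi>1: "continuous_map ?E ?L ?\<Phi>1"
    unfolding left_prod_top_eq_fibre_product continuous_map_into_fibre_product
    using inv_fst continuous_map_fibre_product_projections(2) tE by (auto simp: G.src_inv)
  have \<Psi>1: "continuous_map ?L ?E ?\<Phi>1"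
    unfolding continuous_map_into_fibre_product
    using inv_fst continuous_map_fibre_product_projections(2) tL
    by (auto simp: left_prod_top_eq_fibre_product G.rng_inv)
  have act: "continuous_map ?L (bs_top X) (\<lambda>k. lact X (fst k) (snd k))"
    using continuous_lact by (simp add: case_prod_unfold)
  have "continuous_map ?E (bs_top X) (\<lambda>e. lact X (ginv G (fst e)) (snd e))"
    using continuous_map_compose[OF \<Phi>1 act] by (simp add: o_def)
  then have \<Phi>2: "continuous_map ?E ?L ?\<Phi>2"
    unfolding left_prod_top_eq_fibre_product continuous_map_into_fibre_product
    using continuous_map_fibre_product_projections(1) tE
    by (auto simp: G.inv_closed G.src_inv G.rng_inv lmom_lact)
  have \<Psi>2: "continuous_map ?L ?E ?\<Psi>2"
    unfolding continuous_map_into_fibre_product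
    using act continuous_map_fibre_product_projections(1) tL
    by (auto simp: left_prod_top_eq_fibre_product lmom_lact)
  show "continuous_map ?L euclidean (\<lambda>_. 1::real)" by simp
  show "(0::real) < 1" by simp
  fix u F assume F: "F \<in> Cc ?L"
  obtain K where K: "compactin ?L K" and F0: "\<And>k. k \<notin> K \<Longrightarrow> F k = 0"
    using Cc_borel_compact_support(2)[OF F] by blast
  note mF = Cc_borel_compact_support(1)[OF F]
  let ?sum = "\<Sum>k | k \<in> K \<and> rmom X (snd k) = u. F k"
  have "(LINT x|fibre_counting (bs_top X) (rmom X) u.
      (LINT \<gamma>:fibre (arr_top G) (rng G) (lmom X x)|haar_counting G (lmom X x).
           F (?\<Phi>1 (\<gamma>, x)))) = ?sum"
    using Ga Xa continuous_lmom \<Phi>1 \<Psi>1 _ _ _ mF K F0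
    by (rule iterated_integral_fibre_counting_reparametrise) (simp_all add: tE tL G.inv_inv)
  moreover have "(LINT x|fibre_counting (bs_top X) (rmom X) u.
      (LINT \<gamma>:fibre (arr_top G) (rng G) (lmom X x)|haar_counting G (lmom X x).
           F (?\<Phi>2 (\<gamma>, x)))) = ?sum"
    using Ga Xa continuous_lmom \<Phi>2 \<Psi>2 _ _ _ mF K F0
    by (rule iterated_integral_fibre_counting_reparametrise)
      (simp_all add: tE tL lact_cancel_inv lact_inv_cancel rmom_lact)
  ultimately show "(LINT x|fibre_counting (bs_top X) (rmom X) u.
      (LINT \<gamma>:fibre (arr_top G) (rng G) (lmom X x)|haar_counting G (lmom X x). F (ginv G \<gamma>, x)))
    = (LINT x|fibre_counting (bs_top X) (rmom X) u.
      (LINT \<gamma>:fibre (arr_top G) (rng G) (lmom X x)|haar_counting G (lmom X x).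
        F (\<gamma>, lact X (ginv G \<gamma>) x) * complex_of_real 1))"
    by simp
qed

end

section \<open>Comparison with the point masses\<close>

theorem proposition3p14:
  fixes G :: "'g gpd" and H :: "'h gpd"
    and X :: "('g, 'h, 'x) bisp" and lam :: "'h \<Rightarrow> 'x measure"
  assumes "etale_groupoid G" and "etale_groupoid H"
    and "bispace G H X"
    and "local_homeomorphism (bs_top X) (unit_top H) (rmom X)"
    and "continuous_family (bs_top X) (unit_top H) (rmom X) lam"
    and "full_support (bs_top X) (unit_top H) (rmom X) lam"
    and "topological_correspondence G (haar_counting G) H (haar_counting H) X lam"
  shows "topological_correspondence G (haar_counting G) H (haar_counting H) X
           (fibre_counting (bs_top X) (rmom X))
       \<and> correspondence_isomorphism G H X lam X (fibre_counting (bs_top X) (rmom X)) id"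
proof -
  interpret GE: etale_groupoid G by (rule assms(1))
  interpret HE: etale_groupoid H by (rule assms(2))
  interpret bispace G H X by (rule assms(3))
  interpret full_fibre_measures "bs_top X" "unit_top H" "rmom X" lam
    using assms(4-6) HE.units_Hausdorff HE.units_locally_compact by unfold_locales
  have Ga: "etale_map (arr_top G) (unit_top G) (rng G)"
    using GE.rng_local_homeomorphism GE.units_Hausdorff by unfold_locales
  have Xa: "etale_map (bs_top X) (unit_top H) (rmom X)"
    by (rule etale_map_axioms)
  have units: "u \<in> units H \<Longrightarrow> u \<in> topspace (unit_top H)" for u
    by (simp add: HE.topspace_unit_top)
  let ?\<tau> = "fibre_counting (bs_top X) (rmom X)"
  have "proper_family (bs_top X) (unit_top H) ?\<tau>"
    unfolding proper_family_def
  proof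
    fix u assume "u \<in> topspace (unit_top H)"
    then have "u \<in> rmom X ` topspace (bs_top X)"
      using local_homeomorphismD(2)[OF local_homeo] by simp
    then have "fibre (bs_top X) (rmom X) u \<noteq> {}" by (auto simp: fibre_def)
    moreover have "topspace (bs_top X) \<inter> fibre (bs_top X) (rmom X) u = fibre (bs_top X) (rmom X) u"
      by (auto simp: fibre_def)
    ultimately show "emeasure (?\<tau> u) (topspace (bs_top X)) \<noteq> 0"
      by (simp add: emeasure_fibre_counting sets_borel_of_openin emeasure_count_space_eq_0)
  qed
  moreover have "loc_compact (bs_top X)" "proper_right_action H X"
    using assms(7) by (auto simp: topological_correspondence_def)
  ultimately have "topological_correspondence G (haar_counting G) H (haar_counting H) X ?\<tau>"
    unfolding topological_correspondence_def
    using assms(3) continuous_family_fibre_counting right_invariant_fibre_counting[OF Xa]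
      adjoining_function_fibre_counting[OF Ga Xa] by blast
  moreover have "correspondence_isomorphism G H X lam X ?\<tau> id"
    unfolding correspondence_isomorphism_def
  proof (intro conjI ballI exI[of _ point_mass])
    show "equivariant_homeomorphism G H X X id"
      by (simp add: equivariant_homeomorphism_def homeomorphic_map_id)
    show "continuous_map (bs_top X) euclideanreal point_mass"
      by (rule continuous_point_mass)
    show "0 < point_mass y" if "y \<in> bs_points X" for y
      using that point_mass_pos by (simp add: bs_points_def)
    fix u assume "u \<in> units H"
    then have u: "u \<in> topspace (unit_top H)" by (rule units)
    have distr: "distr (lam u) (borel_of (bs_top X)) id = lam u"
      unfolding id_def using sets_lam[OF u] by (intro distr_id2) simp
    show "absolutely_continuous (?\<tau> u) (distr (lam u) (borel_of (bs_top X)) id)"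
      "absolutely_continuous (distr (lam u) (borel_of (bs_top X)) id) (?\<tau> u)"
      unfolding distr using absolutely_continuous_fibre_counting[OF u] by auto
    show "AE y in ?\<tau> u. RN_deriv (?\<tau> u) (distr (lam u) (borel_of (bs_top X)) id) y
        = ennreal (point_mass y)"
      unfolding distr by (rule RN_deriv_fibre_counting[OF u])
  qed
  ultimately show ?thesis by blast
qed

end
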